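(* Let $A$ be a regular multiplier Hopf algebra and let $L$ be a quasi unitary symmetric partial $A$-module algebra. Then any two minimal enveloping actions of $L$ are isomorphic as $A$-module algebras; that is, if $(R_1,\theta_1,\pi_1)$ and $(R_2,\theta_2,\pi_2)$ are minimal enveloping actions of $L$, there is an isomorphism of $A$-module algebras $R_1\cong R_2$.
   Context: All vector spaces and algebras are over a fixed field $\Bbbk$, $\otimes=\otimes_\Bbbk$; algebras are associative and not necessarily unital. An algebra $B$ has a nondegenerate product if ($ab=0$ for all $b\in B$ implies $a=0$) and ($ab=0$ for all $a\in B$ implies $b=0$). Its multiplier algebra $M(B)$ consists of the pairs $m=(U,V)$ of linear maps $B\to B$ with $V(a)b=aU(b)$ for all $a,b\in B$, with product $(U,V)(U',V')=(U\circ U',V'\circ V)$ and unit $1=(\imath,\imath)$; write $mb=U(b)$, $bm=V(b)$; $B\subseteq M(B)$ via left and right multiplications. A multiplier Hopf algebra is a pair $(A,\Delta)$ where $A$ is an algebra with nondegenerate product and $\Delta:A\to M(A\otimes A)$ is an algebra homomorphism such that $\Delta(a)(1\otimes b)\in A\otimes A$, $(a\otimes 1)\Delta(b)\in A\otimes A$, $(a\otimes 1\otimes 1)((\Delta\otimes \imath)(\Delta(b)(1\otimes c)))=((\imath\otimes\Delta)((a\otimes 1)\Delta(b)))(1\otimes 1\otimes c)$ for all $a,b,c\in A$, and the maps $a\otimes b\mapsto \Delta(a)(1\otimes b)$ and $a\otimes b\mapsto (a\otimes 1)\Delta(b)$ are bijections of $A\otimes A$. It is regular if $(A,\sigma\Delta)$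 is also a multiplier Hopf algebra ($\sigma$ the flip). Known facts: $A$ has bilateral local units (for $a_1,\dots,a_n\in A$ there is $e\in A$ with $ea_i=a_i=a_ie$), there are a unique counit $\varepsilon:A\to\Bbbk$ and antipode $S$, and if $A$ is regular then $S:A\to A$ is a bijective anti-homomorphism. Sweedler notation is used when covered: e.g. $a_{(1)}\otimes a_{(2)}b$ means $\Delta(a)(1\otimes b)$, $a_{(1)}b\otimes a_{(2)}$ means $\Delta(a)(b\otimes 1)$, and similarly for multiplication from the other side and after applying $S^{\pm1}$ to a leg; for regular $A$ these all lie in $A\otimes A$. Left $A$-module algebra: an algebra $R$ with nondegenerate product and a surjective linear map $\triangleright:A\otimes R\to R$ with $a\triangleright(b\triangleright x)=ab\triangleright x$ and $a\triangleright (xy)=(a_{(1)}\triangleright x)(a_{(2)}\triangleright y)$ (covered by writing $y=e\triangleright y$ with $e\in A$). Homomorphisms of $A$-module algebras are algebra homomorphisms commuting with $\triangleright$. Symmetric partial $A$-module algebra: a triple $(L,\cdot,\mathfrak{e})$ with $L$ an algebra with nondegenerate product and linear maps $\cdot:A\otimes L\to L$, $\mathfrak{e}:A\to M(L)$ such that for all $a,b\in A$, $x,y\in L$: (i) $a\cdot(x(b\cdot y))=(a_{(1)}\cdot x)(a_{(2)}b\cdot y)$; (ii) $\mathfrak{e}(a)(b\cdot x)=a_{(1)}\cdot(S(a_{(2)})b\cdot x)$ and $\mathfrak{e}(A)L\subseteq A\cdot L$; (iii) for $a_1,\dots,a_n\in A$, $x_1,\dots,x_m\in L$ there is $b\in A$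 with $a_ib=a_i=ba_i$ and $a_i\cdot x_j=a_i\cdot(b\cdot x_j)$ for all $i,j$; (iv) $A\cdot x=0$ iff $x=0$; (v) $a\cdot((b\cdot x)y)=(a_{(1)}b\cdot x)(a_{(2)}\cdot y)$; (vi) $(b\cdot x)\mathfrak{e}(a)=a_{(2)}\cdot(S^{-1}(a_{(1)})b\cdot x)$; (vii) $L\mathfrak{e}(A)\subseteq A\cdot L$. $L$ is quasi unitary if for all $x_1,\dots,x_n\in L$ there is $b\in A$ with $b\cdot x_i=x_i$ and $ab\cdot x_i=a\cdot x_i$ for all $a\in A$ and all $i$. Symmetric $A$-projection: if $R$ is a left $A$-module algebra and $N\subseteq R$ is a subalgebra with nondegenerate product, a linear multiplicative map $\pi:R\to R$ with image $N$ and $\pi|_N=\mathrm{id}$ is a symmetric $A$-projection over $N$ if $\pi(a\triangleright(x(b\triangleright y)))=\pi(a\triangleright(x\pi(b\triangleright y)))$ and $\pi(a\triangleright((b\triangleright x)y))=\pi(a\triangleright(\pi(b\triangleright x)y))$ for all $x,y\in N$, $a,b\in A$. An enveloping action (globalization) of a symmetric partial $A$-module algebra $L$ is a triple $(R,\theta,\pi)$ with: (i) $R$ a left $A$-module algebra; (ii) $\theta:L\to R$ an algebra monomorphism; (iii) $\theta(L)$ a bilateral ideal of $R$; (iv) $\pi:R\to R$ a symmetric $A$-projection over $\theta(L)$ with $\theta(a\cdot x)=\pi(a\triangleright\theta(x))$ for all $a\in A$, $x\in L$; (v) $R=A\triangleright\theta(L)$ (linear span). An enveloping action $(R,\theta,\pi)$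 is minimal if every $A$-submodule $M$ of $R$ with $\pi(M)=0$ is $0$. *)

theory Defs
  imports "HOL-Algebra.Module" "HOL-Algebra.AbelCoset"
begin

text \<open>Vector spaces and algebras over the field \<open>K\<close> are \<open>module\<close> records with explicit carriers.
  Algebras need not be unital: the field \<open>one\<close> of the record is never constrained, and plays no
  role except in multiplier algebras.\<close>

section \<open>Algebras\<close>

locale nonunital_algebra = field K + module K B
  for K :: "'k ring" and B :: "('k, 'b) module" +
  assumes mult_closed: "\<lbrakk>x \<in> carrier B; y \<in> carrier B\<rbrakk> \<Longrightarrow> x \<otimes>\<^bsub>B\<^esub> y \<in> carrier B"
    and mult_assoc: "\<lbrakk>x \<in> carrier B; y \<in> carrier B; z \<in> carrier B\<rbrakk> \<Longrightarrow>
      (x \<otimes>\<^bsub>B\<^esub> y) \<otimes>\<^bsub>B\<^esub> z = x \<otimes>\<^bsub>B\<^esub> (y \<otimes>\<^bsub>B\<^esub> z)"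
    and mult_l_distr: "\<lbrakk>x \<in> carrier B; y \<in> carrier B; z \<in> carrier B\<rbrakk> \<Longrightarrow>
      (x \<oplus>\<^bsub>B\<^esub> y) \<otimes>\<^bsub>B\<^esub> z = x \<otimes>\<^bsub>B\<^esub> z \<oplus>\<^bsub>B\<^esub> y \<otimes>\<^bsub>B\<^esub> z"
    and mult_r_distr: "\<lbrakk>x \<in> carrier B; y \<in> carrier B; z \<in> carrier B\<rbrakk> \<Longrightarrow>
      x \<otimes>\<^bsub>B\<^esub> (y \<oplus>\<^bsub>B\<^esub> z) = x \<otimes>\<^bsub>B\<^esub> y \<oplus>\<^bsub>B\<^esub> x \<otimes>\<^bsub>B\<^esub> z"
    and smult_mult_l: "\<lbrakk>c \<in> carrier K; x \<in> carrier B; y \<in> carrier B\<rbrakk> \<Longrightarrow>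
      (c \<odot>\<^bsub>B\<^esub> x) \<otimes>\<^bsub>B\<^esub> y = c \<odot>\<^bsub>B\<^esub> (x \<otimes>\<^bsub>B\<^esub> y)"
    and smult_mult_r: "\<lbrakk>c \<in> carrier K; x \<in> carrier B; y \<in> carrier B\<rbrakk> \<Longrightarrow>
      x \<otimes>\<^bsub>B\<^esub> (c \<odot>\<^bsub>B\<^esub> y) = c \<odot>\<^bsub>B\<^esub> (x \<otimes>\<^bsub>B\<^esub> y)"

locale nondegenerate_algebra = nonunital_algebra +
  assumes nondegenerate_l:
      "\<lbrakk>a \<in> carrier B; \<And>b. b \<in> carrier B \<Longrightarrow> a \<otimes>\<^bsub>B\<^esub> b = \<zero>\<^bsub>B\<^esub>\<rbrakk> \<Longrightarrow> a = \<zero>\<^bsub>B\<^esub>"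
    and nondegenerate_r:
      "\<lbrakk>b \<in> carrier B; \<And>a. a \<in> carrier B \<Longrightarrow> a \<otimes>\<^bsub>B\<^esub> b = \<zero>\<^bsub>B\<^esub>\<rbrakk> \<Longrightarrow> b = \<zero>\<^bsub>B\<^esub>"

definition linear_maps :: "'k ring \<Rightarrow> ('k, 'b) module \<Rightarrow> ('k, 'c) module \<Rightarrow> ('b \<Rightarrow> 'c) set" where
  "linear_maps K B C = {f \<in> carrier B \<rightarrow> carrier C.
     (\<forall>x\<in>carrier B. \<forall>y\<in>carrier B. f (x \<oplus>\<^bsub>B\<^esub> y) = f x \<oplus>\<^bsub>C\<^esub> f y) \<and>
     (\<forall>c\<in>carrier K. \<forall>x\<in>carrier B. f (c \<odot>\<^bsub>B\<^esub> x) = c \<odot>\<^bsub>C\<^esub> f x)}"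

definition bilinear_maps ::
    "'k ring \<Rightarrow> ('k, 'a) module \<Rightarrow> ('k, 'b) module \<Rightarrow> ('k, 'c) module \<Rightarrow> ('a \<Rightarrow> 'b \<Rightarrow> 'c) set" where
  "bilinear_maps K A B C = {f.
     (\<forall>a\<in>carrier A. f a \<in> linear_maps K B C) \<and>
     (\<forall>b\<in>carrier B. (\<lambda>a. f a b) \<in> linear_maps K A C)}"

definition algebra_homs :: "'k ring \<Rightarrow> ('k, 'b) module \<Rightarrow> ('k, 'c) module \<Rightarrow> ('b \<Rightarrow> 'c) set" where
  "algebra_homs K B C = {f \<in> linear_maps K B C.
     \<forall>x\<in>carrier B. \<forall>y\<in>carrier B. f (x \<otimes>\<^bsub>B\<^esub> y) = f x \<otimes>\<^bsub>C\<^esub> f y}"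

definition lin_span :: "'k ring \<Rightarrow> ('k, 'b) module \<Rightarrow> 'b set \<Rightarrow> 'b set" where
  "lin_span K B X = \<Inter>{H. submodule H K B \<and> X \<subseteq> H}"

definition subalgebra :: "'k ring \<Rightarrow> ('k, 'b) module \<Rightarrow> 'b set \<Rightarrow> bool" where
  "subalgebra K B N \<longleftrightarrow> submodule N K B \<and> (\<forall>x\<in>N. \<forall>y\<in>N. x \<otimes>\<^bsub>B\<^esub> y \<in> N)"

definition bilateral_ideal :: "'k ring \<Rightarrow> ('k, 'b) module \<Rightarrow> 'b set \<Rightarrow> bool" where
  "bilateral_ideal K B I \<longleftrightarrow>
     submodule I K B \<and> (\<forall>x\<in>I. \<forall>r\<in>carrier B. r \<otimes>\<^bsub>B\<^esub> x \<in> I \<and> x \<otimes>\<^bsub>B\<^esub> r \<in> I)"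


section \<open>Tensor products\<close>

definition free_space :: "'k ring \<Rightarrow> 'x set \<Rightarrow> ('k, 'x \<Rightarrow> 'k) module" where
  "free_space K X = \<lparr>
     carrier = {\<phi>. range \<phi> \<subseteq> carrier K \<and> finite {p. \<phi> p \<noteq> \<zero>\<^bsub>K\<^esub>} \<and> {p. \<phi> p \<noteq> \<zero>\<^bsub>K\<^esub>} \<subseteq> X},
     mult = undefined, one = undefined,
     zero = (\<lambda>p. \<zero>\<^bsub>K\<^esub>), add = (\<lambda>\<phi> \<psi> p. \<phi> p \<oplus>\<^bsub>K\<^esub> \<psi> p), smult = (\<lambda>c \<phi> p. c \<otimes>\<^bsub>K\<^esub> \<phi> p)\<rparr>"

definition free_gen :: "'k ring \<Rightarrow> 'x \<Rightarrow> 'x \<Rightarrow> 'k" where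
  "free_gen K x = (\<lambda>p. if p = x then \<one>\<^bsub>K\<^esub> else \<zero>\<^bsub>K\<^esub>)"

abbreviation free_pairs :: "'k ring \<Rightarrow> ('k, 'a) module \<Rightarrow> ('k, 'b) module \<Rightarrow> ('k, 'a \<times> 'b \<Rightarrow> 'k) module" where
  "free_pairs K A B \<equiv> free_space K (carrier A \<times> carrier B)"

definition tensor_relations ::
    "'k ring \<Rightarrow> ('k, 'a) module \<Rightarrow> ('k, 'b) module \<Rightarrow> ('a \<times> 'b \<Rightarrow> 'k) set" where
  "tensor_relations K A B = (let F = free_pairs K A B; g = free_gen K in lin_span K F (
     {g (a \<oplus>\<^bsub>A\<^esub> a', b) \<ominus>\<^bsub>F\<^esub> (g (a, b) \<oplus>\<^bsub>F\<^esub> g (a', b)) | a a' b.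
        a \<in> carrier A \<and> a' \<in> carrier A \<and> b \<in> carrier B} \<union>
     {g (a, b \<oplus>\<^bsub>B\<^esub> b') \<ominus>\<^bsub>F\<^esub> (g (a, b) \<oplus>\<^bsub>F\<^esub> g (a, b')) | a b b'.
        a \<in> carrier A \<and> b \<in> carrier B \<and> b' \<in> carrier B} \<union>
     {g (c \<odot>\<^bsub>A\<^esub> a, b) \<ominus>\<^bsub>F\<^esub> c \<odot>\<^bsub>F\<^esub> g (a, b) | c a b.
        c \<in> carrier K \<and> a \<in> carrier A \<and> b \<in> carrier B} \<union>
     {g (a, c \<odot>\<^bsub>B\<^esub> b) \<ominus>\<^bsub>F\<^esub> c \<odot>\<^bsub>F\<^esub> g (a, b) | c a b.
        c \<in> carrier K \<and> a \<in> carrier A \<and> b \<in> carrier B}))"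

text \<open>The quotient of the free vector space by the bilinearity relations; its elements are cosets.
  In the scalar multiplication, the relations are added so that scaling by zero gives a full coset.\<close>

definition tensor_space ::
    "'k ring \<Rightarrow> ('k, 'a) module \<Rightarrow> ('k, 'b) module \<Rightarrow> ('k, ('a \<times> 'b \<Rightarrow> 'k) set) module" where
  "tensor_space K A B = (let F = free_pairs K A B; N = tensor_relations K A B in \<lparr>
     carrier = a_rcosets\<^bsub>F\<^esub> N, mult = undefined, one = undefined,
     zero = N, add = set_add F,
     smult = (\<lambda>c X. N <+>\<^bsub>F\<^esub> ((\<lambda>\<phi>. c \<odot>\<^bsub>F\<^esub> \<phi>) ` X))\<rparr>)"

definition tens ::
    "'k ring \<Rightarrow> ('k, 'a) module \<Rightarrow> ('k, 'b) module \<Rightarrow> 'a \<Rightarrow> 'b \<Rightarrow> ('a \<times> 'b \<Rightarrow> 'k) set" where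
  "tens K A B a b = tensor_relations K A B +>\<^bsub>free_pairs K A B\<^esub> free_gen K (a, b)"

text \<open>The linear map into \<open>C\<close> induced by a bilinear map \<open>f\<close>: it sends the sum of the
  \<open>c\<^sub>i (a\<^sub>i \<otimes> b\<^sub>i)\<close> to the sum of the \<open>c\<^sub>i f a\<^sub>i b\<^sub>i\<close>.
  For bilinear \<open>f\<close> the chosen representative is irrelevant.\<close>

definition tensor_lift ::
    "'k ring \<Rightarrow> ('k, 'c) module \<Rightarrow> ('a \<Rightarrow> 'b \<Rightarrow> 'c) \<Rightarrow> ('a \<times> 'b \<Rightarrow> 'k) set \<Rightarrow> 'c" where
  "tensor_lift K C f X = (let \<phi> = (SOME \<phi>. \<phi> \<in> X) in
     \<Oplus>\<^bsub>C\<^esub>p\<in>{p. \<phi> p \<noteq> \<zero>\<^bsub>K\<^esub>}. \<phi> p \<odot>\<^bsub>C\<^esub> f (fst p) (snd p))"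

definition tensor_algebra ::
    "'k ring \<Rightarrow> ('k, 'a) module \<Rightarrow> ('k, 'b) module \<Rightarrow> ('k, ('a \<times> 'b \<Rightarrow> 'k) set) module" where
  "tensor_algebra K A B = (let T = tensor_space K A B in
     T\<lparr>mult := (\<lambda>s t. tensor_lift K T (\<lambda>a b.
        tensor_lift K T (\<lambda>a' b'. tens K A B (a \<otimes>\<^bsub>A\<^esub> a') (b \<otimes>\<^bsub>B\<^esub> b')) t) s)\<rparr>)"


section \<open>Multiplier algebras\<close>

text \<open>A multiplier \<open>m = (U, V)\<close> acts by \<open>m b = fst m b\<close> and \<open>b m = snd m b\<close>.
  The components are extensional on the carrier, so that equal multipliers are equal as pairs.\<close>

definition multiplier_algebra ::
    "'k ring \<Rightarrow> ('k, 'b) module \<Rightarrow> ('k, ('b \<Rightarrow> 'b) \<times> ('b \<Rightarrow> 'b)) module" where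
  "multiplier_algebra K B = \<lparr>
     carrier = {(U, V). U \<in> linear_maps K B B \<inter> extensional (carrier B) \<and>
       V \<in> linear_maps K B B \<inter> extensional (carrier B) \<and>
       (\<forall>a\<in>carrier B. \<forall>b\<in>carrier B. V a \<otimes>\<^bsub>B\<^esub> b = a \<otimes>\<^bsub>B\<^esub> U b)},
     mult = (\<lambda>(U, V) (U', V'). (compose (carrier B) U U', compose (carrier B) V' V)),
     one = (\<lambda>b\<in>carrier B. b, \<lambda>b\<in>carrier B. b),
     zero = (\<lambda>b\<in>carrier B. \<zero>\<^bsub>B\<^esub>, \<lambda>b\<in>carrier B. \<zero>\<^bsub>B\<^esub>),
     add = (\<lambda>(U, V) (U', V'). (\<lambda>b\<in>carrier B. U b \<oplus>\<^bsub>B\<^esub> U' b, \<lambda>b\<in>carrier B. V b \<oplus>\<^bsub>B\<^esub> V' b)),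
     smult = (\<lambda>c (U, V). (\<lambda>b\<in>carrier B. c \<odot>\<^bsub>B\<^esub> U b, \<lambda>b\<in>carrier B. c \<odot>\<^bsub>B\<^esub> V b))\<rparr>"

definition mult_embed :: "('k, 'b) module \<Rightarrow> 'b \<Rightarrow> ('b \<Rightarrow> 'b) \<times> ('b \<Rightarrow> 'b)" where
  "mult_embed B b = (\<lambda>x\<in>carrier B. b \<otimes>\<^bsub>B\<^esub> x, \<lambda>x\<in>carrier B. x \<otimes>\<^bsub>B\<^esub> b)"

text \<open>The element of \<open>B\<close> which a multiplier lying in \<open>B \<subseteq> M(B)\<close> is identified with.\<close>

definition mult_elem :: "('k, 'b) module \<Rightarrow> ('b \<Rightarrow> 'b) \<times> ('b \<Rightarrow> 'b) \<Rightarrow> 'b" where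
  "mult_elem B m = (THE b. b \<in> carrier B \<and> mult_embed B b = m)"

text \<open>The multiplier \<open>m \<otimes> n\<close> of \<open>B \<otimes> C\<close>, for multipliers \<open>m\<close> of \<open>B\<close> and \<open>n\<close> of \<open>C\<close>.\<close>

definition tensor_endo ::
    "'k ring \<Rightarrow> ('k, 'b) module \<Rightarrow> ('k, 'c) module \<Rightarrow> ('b \<Rightarrow> 'b) \<Rightarrow> ('c \<Rightarrow> 'c) \<Rightarrow>
     ('b \<times> 'c \<Rightarrow> 'k) set \<Rightarrow> ('b \<times> 'c \<Rightarrow> 'k) set" where
  "tensor_endo K B C f g = (\<lambda>t\<in>carrier (tensor_algebra K B C).
     tensor_lift K (tensor_algebra K B C) (\<lambda>b c. tens K B C (f b) (g c)) t)"

definition tensor_multiplier ::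
    "'k ring \<Rightarrow> ('k, 'b) module \<Rightarrow> ('k, 'c) module \<Rightarrow>
     ('b \<Rightarrow> 'b) \<times> ('b \<Rightarrow> 'b) \<Rightarrow> ('c \<Rightarrow> 'c) \<times> ('c \<Rightarrow> 'c) \<Rightarrow>
     (('b \<times> 'c \<Rightarrow> 'k) set \<Rightarrow> ('b \<times> 'c \<Rightarrow> 'k) set) \<times> (('b \<times> 'c \<Rightarrow> 'k) set \<Rightarrow> ('b \<times> 'c \<Rightarrow> 'k) set)" where
  "tensor_multiplier K B C m n =
     (tensor_endo K B C (fst m) (fst n), tensor_endo K B C (snd m) (snd n))"

text \<open>The isomorphism \<open>M(B) \<cong> M(C)\<close> extending an algebra isomorphism \<open>f\<close> from \<open>B\<close> to \<open>C\<close>.\<close>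

definition mult_transport ::
    "('k, 'b) module \<Rightarrow> ('k, 'c) module \<Rightarrow> ('b \<Rightarrow> 'c) \<Rightarrow>
     ('b \<Rightarrow> 'b) \<times> ('b \<Rightarrow> 'b) \<Rightarrow> ('c \<Rightarrow> 'c) \<times> ('c \<Rightarrow> 'c)" where
  "mult_transport B C f m =
     (\<lambda>y\<in>carrier C. f (fst m (inv_into (carrier B) f y)),
      \<lambda>y\<in>carrier C. f (snd m (inv_into (carrier B) f y)))"


section \<open>Multiplier Hopf algebras\<close>

type_synonym ('k, 'a) tensor2 = "('a \<times> 'a \<Rightarrow> 'k) set"
type_synonym ('k, 'a) comult =
  "'a \<Rightarrow> (('k, 'a) tensor2 \<Rightarrow> ('k, 'a) tensor2) \<times> (('k, 'a) tensor2 \<Rightarrow> ('k, 'a) tensor2)"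

abbreviation MAA where
  "MAA K A \<equiv> multiplier_algebra K (tensor_algebra K A A)"

text \<open>The multipliers \<open>a \<otimes> 1\<close> and \<open>1 \<otimes> a\<close> of \<open>A \<otimes> A\<close>.\<close>

definition leg1 where
  "leg1 K A a = tensor_multiplier K A A (mult_embed A a) \<one>\<^bsub>multiplier_algebra K A\<^esub>"

definition leg2 where
  "leg2 K A a = tensor_multiplier K A A \<one>\<^bsub>multiplier_algebra K A\<^esub> (mult_embed A a)"

text \<open>The covered coproducts as elements of \<open>A \<otimes> A\<close>: with \<open>r\<close> for \<open>\<Delta>(a)\<close> times a leg, with \<open>l\<close>
  for a leg times \<open>\<Delta>(a)\<close>; the index is the leg which is covered.\<close>

definition cov_r1 :: "'k ring \<Rightarrow> ('k, 'a) module \<Rightarrow> ('k, 'a) comult \<Rightarrow> 'a \<Rightarrow> 'a \<Rightarrow> ('k, 'a) tensor2" where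
  "cov_r1 K A \<Delta> a b = mult_elem (tensor_algebra K A A) (\<Delta> a \<otimes>\<^bsub>MAA K A\<^esub> leg1 K A b)"

definition cov_r2 :: "'k ring \<Rightarrow> ('k, 'a) module \<Rightarrow> ('k, 'a) comult \<Rightarrow> 'a \<Rightarrow> 'a \<Rightarrow> ('k, 'a) tensor2" where
  "cov_r2 K A \<Delta> a b = mult_elem (tensor_algebra K A A) (\<Delta> a \<otimes>\<^bsub>MAA K A\<^esub> leg2 K A b)"

definition cov_l1 :: "'k ring \<Rightarrow> ('k, 'a) module \<Rightarrow> ('k, 'a) comult \<Rightarrow> 'a \<Rightarrow> 'a \<Rightarrow> ('k, 'a) tensor2" where
  "cov_l1 K A \<Delta> b a = mult_elem (tensor_algebra K A A) (leg1 K A b \<otimes>\<^bsub>MAA K A\<^esub> \<Delta> a)"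

definition cov_l2 :: "'k ring \<Rightarrow> ('k, 'a) module \<Rightarrow> ('k, 'a) comult \<Rightarrow> 'a \<Rightarrow> 'a \<Rightarrow> ('k, 'a) tensor2" where
  "cov_l2 K A \<Delta> b a = mult_elem (tensor_algebra K A A) (leg2 K A b \<otimes>\<^bsub>MAA K A\<^esub> \<Delta> a)"

definition flip :: "'k ring \<Rightarrow> ('k, 'a) module \<Rightarrow> ('k, 'a) tensor2 \<Rightarrow> ('k, 'a) tensor2" where
  "flip K A = tensor_lift K (tensor_algebra K A A) (\<lambda>a b. tens K A A b a)"

definition flip_comult :: "'k ring \<Rightarrow> ('k, 'a) module \<Rightarrow> ('k, 'a) comult \<Rightarrow> ('k, 'a) comult" where
  "flip_comult K A \<Delta> a =
     mult_transport (tensor_algebra K A A) (tensor_algebra K A A) (flip K A) (\<Delta> a)"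

text \<open>The threefold tensor product occurs with both bracketings; \<open>assoc_map\<close> identifies
  \<open>(A \<otimes> A) \<otimes> A\<close> with \<open>A \<otimes> (A \<otimes> A)\<close>.\<close>

abbreviation AAA_l where
  "AAA_l K A \<equiv> tensor_algebra K (tensor_algebra K A A) A"

abbreviation AAA_r where
  "AAA_r K A \<equiv> tensor_algebra K A (tensor_algebra K A A)"

definition assoc_map where
  "assoc_map K A = tensor_lift K (AAA_r K A) (\<lambda>t c.
     tensor_lift K (AAA_r K A) (\<lambda>a b. tens K A (tensor_algebra K A A) a (tens K A A b c)) t)"

text \<open>\<open>\<Delta> \<otimes> \<iota>\<close> and \<open>\<iota> \<otimes> \<Delta>\<close> as maps from \<open>A \<otimes> A\<close> to \<open>M((A \<otimes> A) \<otimes> A)\<close> and \<open>M(A \<otimes> (A \<otimes> A))\<close>.\<close>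

definition comult_id where
  "comult_id K A \<Delta> = tensor_lift K (multiplier_algebra K (AAA_l K A))
     (\<lambda>p q. tensor_multiplier K (tensor_algebra K A A) A (\<Delta> p) (mult_embed A q))"

definition id_comult where
  "id_comult K A \<Delta> = tensor_lift K (multiplier_algebra K (AAA_r K A))
     (\<lambda>p q. tensor_multiplier K A (tensor_algebra K A A) (mult_embed A p) (\<Delta> q))"

definition leg1_of3 where
  "leg1_of3 K A a =
     tensor_multiplier K (tensor_algebra K A A) A (leg1 K A a) \<one>\<^bsub>multiplier_algebra K A\<^esub>"

definition leg3_of3 where
  "leg3_of3 K A c =
     tensor_multiplier K A (tensor_algebra K A A) \<one>\<^bsub>multiplier_algebra K A\<^esub> (leg2 K A c)"

locale multiplier_hopf_algebra = nondegenerate_algebra K A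
  for K :: "'k ring" and A :: "('k, 'a) module" +
  fixes \<Delta> :: "('k, 'a) comult"
  assumes comult_hom: "\<Delta> \<in> algebra_homs K A (MAA K A)"
    and cov_r2_in: "\<lbrakk>a \<in> carrier A; b \<in> carrier A\<rbrakk> \<Longrightarrow>
      \<Delta> a \<otimes>\<^bsub>MAA K A\<^esub> leg2 K A b
        \<in> mult_embed (tensor_algebra K A A) ` carrier (tensor_algebra K A A)"
    and cov_l1_in: "\<lbrakk>a \<in> carrier A; b \<in> carrier A\<rbrakk> \<Longrightarrow>
      leg1 K A a \<otimes>\<^bsub>MAA K A\<^esub> \<Delta> b
        \<in> mult_embed (tensor_algebra K A A) ` carrier (tensor_algebra K A A)"
    and coassoc: "\<lbrakk>a \<in> carrier A; b \<in> carrier A; c \<in> carrier A\<rbrakk> \<Longrightarrow>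
      mult_transport (AAA_l K A) (AAA_r K A) (assoc_map K A)
        (leg1_of3 K A a \<otimes>\<^bsub>multiplier_algebra K (AAA_l K A)\<^esub> comult_id K A \<Delta> (cov_r2 K A \<Delta> b c))
      = id_comult K A \<Delta> (cov_l1 K A \<Delta> a b) \<otimes>\<^bsub>multiplier_algebra K (AAA_r K A)\<^esub> leg3_of3 K A c"
    and cov_r2_bij: "bij_betw (tensor_lift K (tensor_algebra K A A) (cov_r2 K A \<Delta>))
      (carrier (tensor_algebra K A A)) (carrier (tensor_algebra K A A))"
    and cov_l1_bij: "bij_betw (tensor_lift K (tensor_algebra K A A) (cov_l1 K A \<Delta>))
      (carrier (tensor_algebra K A A)) (carrier (tensor_algebra K A A))"

locale regular_multiplier_hopf_algebra = multiplier_hopf_algebra +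
  assumes regular: "multiplier_hopf_algebra K A (flip_comult K A \<Delta>)"

definition is_counit :: "'k ring \<Rightarrow> ('k, 'a) module \<Rightarrow> ('k, 'a) comult \<Rightarrow> ('a \<Rightarrow> 'k) \<Rightarrow> bool" where
  "is_counit K A \<Delta> \<epsilon> \<longleftrightarrow>
     \<epsilon> \<in> carrier A \<rightarrow> carrier K \<and>
     (\<forall>a\<in>carrier A. \<forall>b\<in>carrier A. \<epsilon> (a \<oplus>\<^bsub>A\<^esub> b) = \<epsilon> a \<oplus>\<^bsub>K\<^esub> \<epsilon> b) \<and>
     (\<forall>c\<in>carrier K. \<forall>a\<in>carrier A. \<epsilon> (c \<odot>\<^bsub>A\<^esub> a) = c \<otimes>\<^bsub>K\<^esub> \<epsilon> a) \<and>
     (\<forall>a\<in>carrier A. \<forall>b\<in>carrier A. \<epsilon> (a \<otimes>\<^bsub>A\<^esub> b) = \<epsilon> a \<otimes>\<^bsub>K\<^esub> \<epsilon> b) \<and>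
     (\<forall>a\<in>carrier A. \<forall>b\<in>carrier A.
        tensor_lift K A (\<lambda>p q. \<epsilon> p \<odot>\<^bsub>A\<^esub> q) (cov_r2 K A \<Delta> a b) = a \<otimes>\<^bsub>A\<^esub> b \<and>
        tensor_lift K A (\<lambda>p q. \<epsilon> q \<odot>\<^bsub>A\<^esub> p) (cov_l1 K A \<Delta> a b) = a \<otimes>\<^bsub>A\<^esub> b)"

definition counit :: "'k ring \<Rightarrow> ('k, 'a) module \<Rightarrow> ('k, 'a) comult \<Rightarrow> 'a \<Rightarrow> 'k" where
  "counit K A \<Delta> = (THE \<epsilon>. \<epsilon> \<in> extensional (carrier A) \<and> is_counit K A \<Delta> \<epsilon>)"

text \<open>The antipode of a regular multiplier Hopf algebra, characterized by
  \<open>S(a\<^sub>1) a\<^sub>2 b = \<epsilon>(a) b\<close> and \<open>a b\<^sub>1 S(b\<^sub>2) = \<epsilon>(b) a\<close>.\<close>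

definition is_antipode :: "'k ring \<Rightarrow> ('k, 'a) module \<Rightarrow> ('k, 'a) comult \<Rightarrow> ('a \<Rightarrow> 'a) \<Rightarrow> bool" where
  "is_antipode K A \<Delta> S \<longleftrightarrow>
     S \<in> linear_maps K A A \<and>
     (\<forall>a\<in>carrier A. \<forall>b\<in>carrier A.
        tensor_lift K A (\<lambda>p q. S p \<otimes>\<^bsub>A\<^esub> q) (cov_r2 K A \<Delta> a b) = counit K A \<Delta> a \<odot>\<^bsub>A\<^esub> b \<and>
        tensor_lift K A (\<lambda>p q. p \<otimes>\<^bsub>A\<^esub> S q) (cov_l1 K A \<Delta> a b) = counit K A \<Delta> b \<odot>\<^bsub>A\<^esub> a)"

definition antipode :: "'k ring \<Rightarrow> ('k, 'a) module \<Rightarrow> ('k, 'a) comult \<Rightarrow> 'a \<Rightarrow> 'a" where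
  "antipode K A \<Delta> = (THE S. S \<in> extensional (carrier A) \<and> is_antipode K A \<Delta> S)"

definition antipode_inv :: "'k ring \<Rightarrow> ('k, 'a) module \<Rightarrow> ('k, 'a) comult \<Rightarrow> 'a \<Rightarrow> 'a" where
  "antipode_inv K A \<Delta> = inv_into (carrier A) (antipode K A \<Delta>)"


section \<open>Module algebras and partial module algebras\<close>

text \<open>Actions are given as bilinear maps \<open>A \<times> R \<rightarrow> R\<close>, equivalently linear maps on \<open>A \<otimes> R\<close>.\<close>

locale left_module_algebra = nondegenerate_algebra K R
  for K :: "'k ring" and A :: "('k, 'a) module" and \<Delta> :: "('k, 'a) comult"
    and R :: "('k, 'r) module" and act :: "'a \<Rightarrow> 'r \<Rightarrow> 'r" +
  assumes act_bilinear: "act \<in> bilinear_maps K A R R"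
    and act_surj: "tensor_lift K R act ` carrier (tensor_space K A R) = carrier R"
    and act_act: "\<lbrakk>a \<in> carrier A; b \<in> carrier A; x \<in> carrier R\<rbrakk> \<Longrightarrow>
      act a (act b x) = act (a \<otimes>\<^bsub>A\<^esub> b) x"
    and act_mult: "\<lbrakk>a \<in> carrier A; x \<in> carrier R; y \<in> carrier R; e \<in> carrier A; y = act e y\<rbrakk> \<Longrightarrow>
      act a (x \<otimes>\<^bsub>R\<^esub> y) = tensor_lift K R (\<lambda>p q. act p x \<otimes>\<^bsub>R\<^esub> act q y) (cov_r2 K A \<Delta> a e)"

definition module_algebra_iso ::
    "'k ring \<Rightarrow> ('k, 'a) module \<Rightarrow> ('k, 'r) module \<Rightarrow> ('a \<Rightarrow> 'r \<Rightarrow> 'r) \<Rightarrow>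
     ('k, 's) module \<Rightarrow> ('a \<Rightarrow> 's \<Rightarrow> 's) \<Rightarrow> ('r \<Rightarrow> 's) \<Rightarrow> bool" where
  "module_algebra_iso K A R act R' act' f \<longleftrightarrow>
     f \<in> algebra_homs K R R' \<and>
     (\<forall>a\<in>carrier A. \<forall>x\<in>carrier R. f (act a x) = act' a (f x)) \<and>
     bij_betw f (carrier R) (carrier R')"

text \<open>In \<open>e_act\<close> and \<open>act_e\<close> the Sweedler expressions are covered via the antipode:
  \<open>a\<^sub>1 \<otimes> S(a\<^sub>2) b\<close> is the image of \<open>(1 \<otimes> S\<^sup>-\<^sup>1(b)) \<Delta>(a)\<close> under \<open>\<iota> \<otimes> S\<close>, and
  \<open>S\<^sup>-\<^sup>1(a\<^sub>1) b \<otimes> a\<^sub>2\<close> is the image of \<open>(S(b) \<otimes> 1) \<Delta>(a)\<close> under \<open>S\<^sup>-\<^sup>1 \<otimes> \<iota>\<close>.\<close>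

locale symmetric_partial_module_algebra = nondegenerate_algebra K L
  for K :: "'k ring" and A :: "('k, 'a) module" and \<Delta> :: "('k, 'a) comult"
    and L :: "('k, 'l) module" and pact :: "'a \<Rightarrow> 'l \<Rightarrow> 'l" (infixr \<open>\<cdot>\<close> 75)
    and \<ee> :: "'a \<Rightarrow> ('l \<Rightarrow> 'l) \<times> ('l \<Rightarrow> 'l)" +
  assumes pact_bilinear: "pact \<in> bilinear_maps K A L L"
    and e_linear: "\<ee> \<in> linear_maps K A (multiplier_algebra K L)"
    and pact_mult_l: "\<lbrakk>a \<in> carrier A; b \<in> carrier A; x \<in> carrier L; y \<in> carrier L\<rbrakk> \<Longrightarrow>
      a \<cdot> (x \<otimes>\<^bsub>L\<^esub> (b \<cdot> y)) = tensor_lift K L (\<lambda>p q. (p \<cdot> x) \<otimes>\<^bsub>L\<^esub> (q \<cdot> y)) (cov_r2 K A \<Delta> a b)"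
    and e_act: "\<lbrakk>a \<in> carrier A; b \<in> carrier A; x \<in> carrier L\<rbrakk> \<Longrightarrow>
      fst (\<ee> a) (b \<cdot> x) = tensor_lift K L (\<lambda>p q. p \<cdot> (antipode K A \<Delta> q \<cdot> x))
        (cov_l2 K A \<Delta> (antipode_inv K A \<Delta> b) a)"
    and e_act_in: "\<lbrakk>a \<in> carrier A; x \<in> carrier L\<rbrakk> \<Longrightarrow>
      fst (\<ee> a) x \<in> lin_span K L {b \<cdot> y | b y. b \<in> carrier A \<and> y \<in> carrier L}"
    and pact_local_units: "\<lbrakk>finite X; X \<subseteq> carrier A; finite Y; Y \<subseteq> carrier L\<rbrakk> \<Longrightarrow>
      \<exists>b\<in>carrier A. \<forall>a\<in>X. a \<otimes>\<^bsub>A\<^esub> b = a \<and> b \<otimes>\<^bsub>A\<^esub> a = a \<and> (\<forall>x\<in>Y. a \<cdot> x = a \<cdot> (b \<cdot> x))"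
    and pact_faithful: "x \<in> carrier L \<Longrightarrow> (\<forall>a\<in>carrier A. a \<cdot> x = \<zero>\<^bsub>L\<^esub>) \<longleftrightarrow> x = \<zero>\<^bsub>L\<^esub>"
    and pact_mult_r: "\<lbrakk>a \<in> carrier A; b \<in> carrier A; x \<in> carrier L; y \<in> carrier L\<rbrakk> \<Longrightarrow>
      a \<cdot> ((b \<cdot> x) \<otimes>\<^bsub>L\<^esub> y) = tensor_lift K L (\<lambda>p q. (p \<cdot> x) \<otimes>\<^bsub>L\<^esub> (q \<cdot> y)) (cov_r1 K A \<Delta> a b)"
    and act_e: "\<lbrakk>a \<in> carrier A; b \<in> carrier A; x \<in> carrier L\<rbrakk> \<Longrightarrow>
      snd (\<ee> a) (b \<cdot> x) = tensor_lift K L (\<lambda>p q. q \<cdot> (antipode_inv K A \<Delta> p \<cdot> x))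
        (cov_l1 K A \<Delta> (antipode K A \<Delta> b) a)"
    and act_e_in: "\<lbrakk>a \<in> carrier A; x \<in> carrier L\<rbrakk> \<Longrightarrow>
      snd (\<ee> a) x \<in> lin_span K L {b \<cdot> y | b y. b \<in> carrier A \<and> y \<in> carrier L}"

definition quasi_unitary :: "('k, 'a) module \<Rightarrow> ('k, 'l) module \<Rightarrow> ('a \<Rightarrow> 'l \<Rightarrow> 'l) \<Rightarrow> bool" where
  "quasi_unitary A L pact \<longleftrightarrow> (\<forall>X. finite X \<and> X \<subseteq> carrier L \<longrightarrow>
     (\<exists>b\<in>carrier A. \<forall>x\<in>X. pact b x = x \<and> (\<forall>a\<in>carrier A. pact (a \<otimes>\<^bsub>A\<^esub> b) x = pact a x)))"


section \<open>Enveloping actions\<close>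

definition symmetric_projection ::
    "'k ring \<Rightarrow> ('k, 'a) module \<Rightarrow> ('k, 'r) module \<Rightarrow> ('a \<Rightarrow> 'r \<Rightarrow> 'r) \<Rightarrow> 'r set \<Rightarrow> ('r \<Rightarrow> 'r) \<Rightarrow> bool" where
  "symmetric_projection K A R act N \<pi> \<longleftrightarrow>
     subalgebra K R N \<and> nondegenerate_algebra K (R\<lparr>carrier := N\<rparr>) \<and>
     \<pi> \<in> algebra_homs K R R \<and> \<pi> ` carrier R = N \<and> (\<forall>x\<in>N. \<pi> x = x) \<and>
     (\<forall>a\<in>carrier A. \<forall>b\<in>carrier A. \<forall>x\<in>N. \<forall>y\<in>N.
        \<pi> (act a (x \<otimes>\<^bsub>R\<^esub> act b y)) = \<pi> (act a (x \<otimes>\<^bsub>R\<^esub> \<pi> (act b y))) \<and>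
        \<pi> (act a (act b x \<otimes>\<^bsub>R\<^esub> y)) = \<pi> (act a (\<pi> (act b x) \<otimes>\<^bsub>R\<^esub> y)))"

locale enveloping_action = left_module_algebra K A \<Delta> R act
  for K :: "'k ring" and A :: "('k, 'a) module" and \<Delta> :: "('k, 'a) comult"
    and L :: "('k, 'l) module" and pact :: "'a \<Rightarrow> 'l \<Rightarrow> 'l"
    and R :: "('k, 'r) module" and act :: "'a \<Rightarrow> 'r \<Rightarrow> 'r"
    and \<theta> :: "'l \<Rightarrow> 'r" and \<pi> :: "'r \<Rightarrow> 'r" +
  assumes theta_hom: "\<theta> \<in> algebra_homs K L R"
    and theta_inj: "inj_on \<theta> (carrier L)"
    and theta_ideal: "bilateral_ideal K R (\<theta> ` carrier L)"
    and proj: "symmetric_projection K A R act (\<theta> ` carrier L) \<pi>"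
    and theta_act: "\<lbrakk>a \<in> carrier A; x \<in> carrier L\<rbrakk> \<Longrightarrow> \<theta> (pact a x) = \<pi> (act a (\<theta> x))"
    and generated:
      "carrier R = lin_span K R {act a (\<theta> x) | a x. a \<in> carrier A \<and> x \<in> carrier L}"

locale minimal_enveloping_action = enveloping_action +
  assumes minimal: "\<lbrakk>submodule M K R; \<And>a m. \<lbrakk>a \<in> carrier A; m \<in> M\<rbrakk> \<Longrightarrow> act a m \<in> M;
      \<pi> ` M = {\<zero>\<^bsub>R\<^esub>}\<rbrakk> \<Longrightarrow> M = {\<zero>\<^bsub>R\<^esub>}"

end

theory Submission
  imports Defs
begin

text \<open>The isomorphism is the correspondence \<open>\<Sum> a\<^sub>i \<triangleright> \<theta>\<^sub>1(x\<^sub>i) \<mapsto> \<Sum> a\<^sub>i \<triangleright> \<theta>\<^sub>2(x\<^sub>i)\<close>.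
  An element \<open>u\<close> of a minimal enveloping action is determined by the family \<open>\<pi>(b \<triangleright> u)\<close>, \<open>b \<in> A\<close>:
  if the family vanishes, then so does \<open>\<pi>\<close> on the submodule generated by \<open>u\<close>, because \<open>u = e \<triangleright> u\<close>
  for a local unit \<open>e\<close>. Call \<open>u \<in> R\<^sub>1\<close> and \<open>v \<in> R\<^sub>2\<close> linked if the two families are the images
  under \<open>\<theta>\<^sub>1\<close> and \<open>\<theta>\<^sub>2\<close> of the same family in \<open>L\<close>. The generators \<open>a \<triangleright> \<theta>\<^sub>1(x)\<close> and \<open>a \<triangleright> \<theta>\<^sub>2(x)\<close>
  are linked through \<open>b \<mapsto> ba \<cdot> x\<close>, and the relation is compatible with sums, scalars and the
  action. It is compatible with products because
  \<open>\<pi>(b \<triangleright> uu') = \<pi>(b\<^sub>1 \<triangleright> u) \<pi>(b\<^sub>2 \<triangleright> u')\<close>. Hence it is the graph of the isomorphism.\<close>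

section \<open>Linear and bilinear maps\<close>

text \<open>Additive inverses are multiples by minus one, so the spans, kernels and relation domains
  below are recognised as submodules from zero, sums and scalars alone.\<close>

lemma submodule_smultI:
  assumes "module K V" "H \<subseteq> carrier V" "\<zero>\<^bsub>V\<^esub> \<in> H"
    and add: "\<And>x y. x \<in> H \<Longrightarrow> y \<in> H \<Longrightarrow> x \<oplus>\<^bsub>V\<^esub> y \<in> H"
    and smult: "\<And>c x. c \<in> carrier K \<Longrightarrow> x \<in> H \<Longrightarrow> c \<odot>\<^bsub>V\<^esub> x \<in> H"
  shows "submodule H K V"
proof -
  interpret module K V by fact
  show ?thesis
  proof (rule submoduleI)
    fix x assume "x \<in> H"
    then have "x \<in> carrier V" "(\<ominus>\<^bsub>K\<^esub> \<one>\<^bsub>K\<^esub>) \<odot>\<^bsub>V\<^esub> x \<in> H"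
      using assms by auto
    then show "\<ominus>\<^bsub>V\<^esub> x \<in> H" by (simp add: smult_l_minus)
  qed (use assms in auto)
qed

lemma lin_span_submodule:
  assumes "module K V" "X \<subseteq> carrier V"
  shows "submodule (lin_span K V X) K V"
proof -
  interpret module K V by fact
  \<comment> \<open>The family being intersected has a member, which keeps the span inside the
    carrier; an empty intersection would be the whole type.\<close>
  have carr: "carrier V \<in> {H. submodule H K V \<and> X \<subseteq> H}"
    using assms(2) carrier_is_submodule by simp
  show ?thesis
  proof (rule submodule_smultI[OF assms(1)])
    show "lin_span K V X \<subseteq> carrier V" using carr unfolding lin_span_def by blast
    show "\<zero>\<^bsub>V\<^esub> \<in> lin_span K V X"
      unfolding lin_span_def by (auto dest!: submodule.axioms(1) subgroup.one_closed)
  qed (auto simp: lin_span_def submoduleE)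
qed

lemma lin_span_base: "X \<subseteq> lin_span K V X"
  unfolding lin_span_def by blast

lemma lin_span_minimal: "submodule H K V \<Longrightarrow> X \<subseteq> H \<Longrightarrow> lin_span K V X \<subseteq> H"
  unfolding lin_span_def by blast

lemma linear_mapsD:
  assumes "f \<in> linear_maps K V W"
  shows "x \<in> carrier V \<Longrightarrow> f x \<in> carrier W"
    and "x \<in> carrier V \<Longrightarrow> y \<in> carrier V \<Longrightarrow> f (x \<oplus>\<^bsub>V\<^esub> y) = f x \<oplus>\<^bsub>W\<^esub> f y"
    and "c \<in> carrier K \<Longrightarrow> x \<in> carrier V \<Longrightarrow> f (c \<odot>\<^bsub>V\<^esub> x) = c \<odot>\<^bsub>W\<^esub> f x"
  using assms unfolding linear_maps_def by auto

lemma bilinear_map_simps: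
  assumes "f \<in> bilinear_maps K U V W"
  shows "a \<in> carrier U \<Longrightarrow> b \<in> carrier V \<Longrightarrow> f a b \<in> carrier W"
    and "a \<in> carrier U \<Longrightarrow> a' \<in> carrier U \<Longrightarrow> b \<in> carrier V \<Longrightarrow> f (a \<oplus>\<^bsub>U\<^esub> a') b = f a b \<oplus>\<^bsub>W\<^esub> f a' b"
    and "a \<in> carrier U \<Longrightarrow> b \<in> carrier V \<Longrightarrow> b' \<in> carrier V \<Longrightarrow> f a (b \<oplus>\<^bsub>V\<^esub> b') = f a b \<oplus>\<^bsub>W\<^esub> f a b'"
    and "c \<in> carrier K \<Longrightarrow> a \<in> carrier U \<Longrightarrow> b \<in> carrier V \<Longrightarrow> f (c \<odot>\<^bsub>U\<^esub> a) b = c \<odot>\<^bsub>W\<^esub> f a b"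
    and "c \<in> carrier K \<Longrightarrow> a \<in> carrier U \<Longrightarrow> b \<in> carrier V \<Longrightarrow> f a (c \<odot>\<^bsub>V\<^esub> b) = c \<odot>\<^bsub>W\<^esub> f a b"
  using assms unfolding bilinear_maps_def linear_maps_def by auto

lemma linear_map_zero:
  assumes "module K V" "module K W" "f \<in> linear_maps K V W"
  shows "f \<zero>\<^bsub>V\<^esub> = \<zero>\<^bsub>W\<^esub>"
proof -
  interpret V: module K V by fact
  interpret W: module K W by fact
  have "f (\<zero>\<^bsub>K\<^esub> \<odot>\<^bsub>V\<^esub> \<zero>\<^bsub>V\<^esub>) = \<zero>\<^bsub>K\<^esub> \<odot>\<^bsub>W\<^esub> f \<zero>\<^bsub>V\<^esub>"
    by (rule linear_mapsD(3)[OF assms(3)]) auto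
  then show ?thesis using linear_mapsD(1)[OF assms(3)] by simp
qed

lemma linear_map_minus:
  assumes "module K V" "module K W" "f \<in> linear_maps K V W" "x \<in> carrier V" "y \<in> carrier V"
  shows "f (x \<ominus>\<^bsub>V\<^esub> y) = f x \<ominus>\<^bsub>W\<^esub> f y"
proof -
  interpret V: module K V by fact
  interpret W: module K W by fact
  note f = linear_mapsD[OF assms(3)]
  have "f (x \<ominus>\<^bsub>V\<^esub> y) = f (x \<oplus>\<^bsub>V\<^esub> (\<ominus>\<^bsub>K\<^esub> \<one>\<^bsub>K\<^esub>) \<odot>\<^bsub>V\<^esub> y)"
    using assms by (simp add: a_minus_def V.smult_l_minus)
  also have "\<dots> = f x \<ominus>\<^bsub>W\<^esub> f y"
    using assms f(1) by (simp add: f(2,3) a_minus_def W.smult_l_minus)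
  finally show ?thesis .
qed

text \<open>\<open>tensor_lift\<close> produces sums of exactly this shape, so passing a linear map
  through a lift comes down to this induction.\<close>

lemma linear_map_lincomb:
  assumes "module K V" "module K W" "f \<in> linear_maps K V W" "finite S"
    "\<And>p. p \<in> S \<Longrightarrow> c p \<in> carrier K" "\<And>p. p \<in> S \<Longrightarrow> v p \<in> carrier V"
  shows "f (\<Oplus>\<^bsub>V\<^esub>p\<in>S. c p \<odot>\<^bsub>V\<^esub> v p) = (\<Oplus>\<^bsub>W\<^esub>p\<in>S. c p \<odot>\<^bsub>W\<^esub> f (v p))"
proof -
  interpret V: module K V by fact
  interpret W: module K W by fact
  note f = linear_mapsD[OF assms(3)]
  show ?thesis
    using assms(4-6)
  proof (induction S rule: finite_induct)
    case empty
    show ?case by (simp add: linear_map_zero[OF assms(1-3)])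
  next
    case (insert q S)
    then have "f (\<Oplus>\<^bsub>V\<^esub>p\<in>insert q S. c p \<odot>\<^bsub>V\<^esub> v p)
        = f (c q \<odot>\<^bsub>V\<^esub> v q \<oplus>\<^bsub>V\<^esub> (\<Oplus>\<^bsub>V\<^esub>p\<in>S. c p \<odot>\<^bsub>V\<^esub> v p))"
      by (subst V.finsum_insert) auto
    also have "\<dots> = c q \<odot>\<^bsub>W\<^esub> f (v q) \<oplus>\<^bsub>W\<^esub> (\<Oplus>\<^bsub>W\<^esub>p\<in>S. c p \<odot>\<^bsub>W\<^esub> f (v p))"
      using insert by (subst f(2)) (auto simp: f(3) intro!: V.finsum_closed)
    also have "\<dots> = (\<Oplus>\<^bsub>W\<^esub>p\<in>insert q S. c p \<odot>\<^bsub>W\<^esub> f (v p))"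
      using insert by (subst W.finsum_insert) (auto intro: f(1))
    finally show ?case .
  qed
qed

section \<open>Free spaces and tensor products\<close>

lemma free_space_module:
  assumes "cring K"
  shows "module K (free_space K X)"
proof -
  interpret cring K by fact
  let ?F = "free_space K X"
  \<comment> \<open>The support of a pointwise operation lies in the union of the supports of its
    arguments. Negation and scaling are covered by supplying the same argument twice.\<close>
  have fin: "finite {p. h p \<noteq> \<zero>\<^bsub>K\<^esub>} \<and> {p. h p \<noteq> \<zero>\<^bsub>K\<^esub>} \<subseteq> X"
    if "\<phi> \<in> carrier ?F" "\<psi> \<in> carrier ?F" "\<And>p. \<phi> p = \<zero>\<^bsub>K\<^esub> \<Longrightarrow> \<psi> p = \<zero>\<^bsub>K\<^esub> \<Longrightarrow> h p = \<zero>\<^bsub>K\<^esub>"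
    for \<phi> \<psi> h
  proof -
    have "{p. h p \<noteq> \<zero>\<^bsub>K\<^esub>} \<subseteq> {p. \<phi> p \<noteq> \<zero>\<^bsub>K\<^esub>} \<union> {p. \<psi> p \<noteq> \<zero>\<^bsub>K\<^esub>}" using that(3) by blast
    then show ?thesis using that(1,2)
      by (auto simp: free_space_def intro: finite_subset)
  qed
  have carrI: "h \<in> carrier ?F"
    if "\<phi> \<in> carrier ?F" "\<psi> \<in> carrier ?F" "\<And>p. \<phi> p = \<zero>\<^bsub>K\<^esub> \<Longrightarrow> \<psi> p = \<zero>\<^bsub>K\<^esub> \<Longrightarrow> h p = \<zero>\<^bsub>K\<^esub>"
      "\<And>p. h p \<in> carrier K" for \<phi> \<psi> h
    using fin[OF that(1-3)] that(4) by (auto simp: free_space_def)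
  have val: "\<phi> p \<in> carrier K" if "\<phi> \<in> carrier ?F" for \<phi> p
    using that by (auto simp: free_space_def)
  have ops: "\<zero>\<^bsub>?F\<^esub> = (\<lambda>p. \<zero>\<^bsub>K\<^esub>)" "\<And>\<phi> \<psi>. \<phi> \<oplus>\<^bsub>?F\<^esub> \<psi> = (\<lambda>p. \<phi> p \<oplus>\<^bsub>K\<^esub> \<psi> p)"
    "\<And>c \<phi>. c \<odot>\<^bsub>?F\<^esub> \<phi> = (\<lambda>p. c \<otimes>\<^bsub>K\<^esub> \<phi> p)"
    by (simp_all add: free_space_def)
  show ?thesis
  proof (rule moduleI[OF assms])
    show "abelian_group ?F"
    proof (rule abelian_groupI)
      fix x y assume xy: "x \<in> carrier ?F" "y \<in> carrier ?F"
      show "x \<oplus>\<^bsub>?F\<^esub> y \<in> carrier ?F"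
        by (rule carrI[OF xy]) (auto simp: ops val xy)
      show "x \<oplus>\<^bsub>?F\<^esub> y = y \<oplus>\<^bsub>?F\<^esub> x" using xy by (simp add: ops val a_comm)
      show "\<zero>\<^bsub>?F\<^esub> \<oplus>\<^bsub>?F\<^esub> x = x" using xy by (simp add: ops val)
      have "(\<lambda>p. \<ominus>\<^bsub>K\<^esub> x p) \<in> carrier ?F"
        by (rule carrI[OF xy(1,1)]) (auto simp: val xy)
      moreover have "(\<lambda>p. \<ominus>\<^bsub>K\<^esub> x p) \<oplus>\<^bsub>?F\<^esub> x = \<zero>\<^bsub>?F\<^esub>" using xy by (simp add: ops val l_neg)
      ultimately show "\<exists>y\<in>carrier ?F. y \<oplus>\<^bsub>?F\<^esub> x = \<zero>\<^bsub>?F\<^esub>" by blast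
    next
      show "\<zero>\<^bsub>?F\<^esub> \<in> carrier ?F" by (auto simp: free_space_def)
    qed (simp add: ops val a_assoc)
    fix c x assume "c \<in> carrier K" and x: "x \<in> carrier ?F"
    then show "c \<odot>\<^bsub>?F\<^esub> x \<in> carrier ?F"
      by (intro carrI[OF x x]) (auto simp: ops val)
  qed (simp_all add: ops val l_distr r_distr m_assoc)
qed

lemma free_gen_carrier:
  assumes "cring K" "x \<in> X"
  shows "free_gen K x \<in> carrier (free_space K X)"
proof -
  interpret cring K by fact
  \<comment> \<open>Only an inclusion: over the zero ring the support of a generator is
    empty.\<close>
  have "{p. free_gen K x p \<noteq> \<zero>\<^bsub>K\<^esub>} \<subseteq> {x}" by (auto simp: free_gen_def)
  then have "finite {p. free_gen K x p \<noteq> \<zero>\<^bsub>K\<^esub>} \<and> {p. free_gen K x p \<noteq> \<zero>\<^bsub>K\<^esub>} \<subseteq> X"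
    using assms(2) finite_subset by blast
  then show ?thesis by (auto simp: free_space_def free_gen_def)
qed

lemma free_space_expand:
  assumes "cring K" "\<phi> \<in> carrier (free_space K X)"
  shows "(\<Oplus>\<^bsub>free_space K X\<^esub>p\<in>{p. \<phi> p \<noteq> \<zero>\<^bsub>K\<^esub>}. \<phi> p \<odot>\<^bsub>free_space K X\<^esub> free_gen K p) = \<phi>"
proof -
  interpret cring K by fact
  interpret F: module K "free_space K X" by (rule free_space_module) fact
  let ?F = "free_space K X"
  have val: "\<phi> p \<in> carrier K" for p using assms(2) by (auto simp: free_space_def)
  \<comment> \<open>The sum over any finite set of generators is \<open>\<phi>\<close> cut off
    outside that set. This form can be proved by induction, and the support of \<open>\<phi>\<close>
    is the instance wanted.\<close>
  have "(\<Oplus>\<^bsub>?F\<^esub>p\<in>S. \<phi> p \<odot>\<^bsub>?F\<^esub> free_gen K p) = (\<lambda>q. if q \<in> S then \<phi> q else \<zero>\<^bsub>K\<^esub>)"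
    if "finite S" "S \<subseteq> X" for S
    using that
  proof (induction S rule: finite_induct)
    case empty
    show ?case unfolding F.finsum_empty by (simp add: free_space_def)
  next
    case (insert x S)
    then have "(\<Oplus>\<^bsub>?F\<^esub>p\<in>insert x S. \<phi> p \<odot>\<^bsub>?F\<^esub> free_gen K p)
        = \<phi> x \<odot>\<^bsub>?F\<^esub> free_gen K x \<oplus>\<^bsub>?F\<^esub> (\<lambda>q. if q \<in> S then \<phi> q else \<zero>\<^bsub>K\<^esub>)"
      using val
      by (subst F.finsum_insert) (auto intro!: F.smult_closed free_gen_carrier[OF assms(1)])
    also have "\<dots> = (\<lambda>q. if q \<in> insert x S then \<phi> q else \<zero>\<^bsub>K\<^esub>)"
      using insert val by (auto simp: free_space_def free_gen_def fun_eq_iff)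
    finally show ?case .
  qed
  from this[of "{p. \<phi> p \<noteq> \<zero>\<^bsub>K\<^esub>}"] assms(2) show ?thesis
    by (auto simp: free_space_def)
qed

text \<open>The sum inside \<open>tensor_lift\<close> as a function of the representative, that is,
  the linear extension of \<open>f\<close> from the free generators. Separated from the choice of
  representative, it can be stated to be linear.\<close>

definition free_eval :: "'k ring \<Rightarrow> ('k, 'c) module \<Rightarrow> ('x \<Rightarrow> 'c) \<Rightarrow> ('x \<Rightarrow> 'k) \<Rightarrow> 'c" where
  "free_eval K C f \<phi> = (\<Oplus>\<^bsub>C\<^esub>p\<in>{p. \<phi> p \<noteq> \<zero>\<^bsub>K\<^esub>}. \<phi> p \<odot>\<^bsub>C\<^esub> f p)"

lemma free_eval_linear:
  assumes "module K C" and f: "\<And>p. p \<in> X \<Longrightarrow> f p \<in> carrier C"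
  shows "free_eval K C f \<in> linear_maps K (free_space K X) C"
proof -
  interpret module K C by fact
  let ?F = "free_space K X"
  have val: "\<phi> p \<in> carrier K" if "\<phi> \<in> carrier ?F" for \<phi> p
    using that by (auto simp: free_space_def)
  have supp: "finite {p. \<phi> p \<noteq> \<zero>\<^bsub>K\<^esub>}" "{p. \<phi> p \<noteq> \<zero>\<^bsub>K\<^esub>} \<subseteq> X" if "\<phi> \<in> carrier ?F" for \<phi>
    using that by (auto simp: free_space_def)
  \<comment> \<open>Different elements have different supports. Extending the sums by zero terms to
    a common finite index set makes them comparable term by term.\<close>
  have enlarge: "free_eval K C f \<phi> = (\<Oplus>\<^bsub>C\<^esub>p\<in>S. \<phi> p \<odot>\<^bsub>C\<^esub> f p)"
    if "\<phi> \<in> carrier ?F" "finite S" "S \<subseteq> X" "{p. \<phi> p \<noteq> \<zero>\<^bsub>K\<^esub>} \<subseteq> S" for \<phi> S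
    unfolding free_eval_def
    using that val[OF that(1)] f
    by (intro add.finprod_mono_neutral_cong_left) auto
  have closed: "(\<lambda>p. \<phi> p \<odot>\<^bsub>C\<^esub> f p) \<in> S \<rightarrow> carrier C" if "\<phi> \<in> carrier ?F" "S \<subseteq> X" for \<phi> S
    using that f val by auto
  interpret F: module K ?F by (rule free_space_module) (rule is_cring)
  show ?thesis
    unfolding linear_maps_def
  proof (intro CollectI conjI ballI)
    show "free_eval K C f \<in> carrier ?F \<rightarrow> carrier C"
      unfolding free_eval_def using closed supp by (auto intro!: finsum_closed)
  next
    fix \<phi> \<psi> assume \<phi>: "\<phi> \<in> carrier ?F" and \<psi>: "\<psi> \<in> carrier ?F"
    let ?S = "{p. \<phi> p \<noteq> \<zero>\<^bsub>K\<^esub>} \<union> {p. \<psi> p \<noteq> \<zero>\<^bsub>K\<^esub>}"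
    have S: "finite ?S" "?S \<subseteq> X" using supp \<phi> \<psi> by auto
    have "free_eval K C f (\<phi> \<oplus>\<^bsub>?F\<^esub> \<psi>) = (\<Oplus>\<^bsub>C\<^esub>p\<in>?S. (\<phi> \<oplus>\<^bsub>?F\<^esub> \<psi>) p \<odot>\<^bsub>C\<^esub> f p)"
      by (intro enlarge S F.a_closed \<phi> \<psi>) (auto simp: free_space_def)
    also have "\<dots> = (\<Oplus>\<^bsub>C\<^esub>p\<in>?S. \<phi> p \<odot>\<^bsub>C\<^esub> f p \<oplus>\<^bsub>C\<^esub> \<psi> p \<odot>\<^bsub>C\<^esub> f p)"
      using S val \<phi> \<psi> f
      by (intro add.finprod_cong') (auto simp: free_space_def smult_l_distr subset_iff)
    also have "\<dots> = (\<Oplus>\<^bsub>C\<^esub>p\<in>?S. \<phi> p \<odot>\<^bsub>C\<^esub> f p) \<oplus>\<^bsub>C\<^esub> (\<Oplus>\<^bsub>C\<^esub>p\<in>?S. \<psi> p \<odot>\<^bsub>C\<^esub> f p)"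
      by (intro finsum_addf closed \<phi> \<psi> S)
    also have "\<dots> = free_eval K C f \<phi> \<oplus>\<^bsub>C\<^esub> free_eval K C f \<psi>"
      using enlarge[OF \<phi> S] enlarge[OF \<psi> S] by simp
    finally show "free_eval K C f (\<phi> \<oplus>\<^bsub>?F\<^esub> \<psi>) = free_eval K C f \<phi> \<oplus>\<^bsub>C\<^esub> free_eval K C f \<psi>" .
  next
    fix c \<phi> assume c: "c \<in> carrier K" and \<phi>: "\<phi> \<in> carrier ?F"
    let ?S = "{p. \<phi> p \<noteq> \<zero>\<^bsub>K\<^esub>}"
    note S = supp[OF \<phi>]
    have "free_eval K C f (c \<odot>\<^bsub>?F\<^esub> \<phi>) = (\<Oplus>\<^bsub>C\<^esub>p\<in>?S. (c \<odot>\<^bsub>?F\<^esub> \<phi>) p \<odot>\<^bsub>C\<^esub> f p)"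
      by (intro enlarge S F.smult_closed \<phi> c) (use c in \<open>auto simp: free_space_def\<close>)
    also have "\<dots> = (\<Oplus>\<^bsub>C\<^esub>p\<in>?S. c \<odot>\<^bsub>C\<^esub> (\<phi> p \<odot>\<^bsub>C\<^esub> f p))"
      using S val \<phi> c f
      by (intro add.finprod_cong') (auto simp: free_space_def smult_assoc1 subset_iff)
    also have "\<dots> = c \<odot>\<^bsub>C\<^esub> free_eval K C f \<phi>"
      unfolding free_eval_def using c S closed[OF \<phi>] by (subst finsum_smult_ldistr) auto
    finally show "free_eval K C f (c \<odot>\<^bsub>?F\<^esub> \<phi>) = c \<odot>\<^bsub>C\<^esub> free_eval K C f \<phi>" .
  qed
qed

lemma free_eval_gen:
  assumes "module K C" "f x \<in> carrier C"
  shows "free_eval K C f (free_gen K x) = f x"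
proof -
  interpret module K C by fact
  \<comment> \<open>Over the zero ring a generator has empty support and evaluates to zero; this is
    still \<open>f x\<close>, because every module over that ring is zero.\<close>
  have "f x = \<zero>\<^bsub>C\<^esub>" if "\<one>\<^bsub>K\<^esub> = \<zero>\<^bsub>K\<^esub>"
    using that smult_one[OF assms(2)] smult_l_null[OF assms(2)] by simp
  then have "free_eval K C f (free_gen K x) = (\<Oplus>\<^bsub>C\<^esub>p\<in>{x}. free_gen K x p \<odot>\<^bsub>C\<^esub> f p)"
    unfolding free_eval_def
    using assms(2) by (intro add.finprod_mono_neutral_cong_left) (auto simp: free_gen_def)
  also have "\<dots> = f x" using assms(2) by (simp add: free_gen_def)
  finally show ?thesis .
qed

section \<open>The tensor product as a quotient, and its universal property\<close>

locale tensor_factors = A: module K A + B: module K B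
  for K :: "'k ring" and A :: "('k, 'a) module" and B :: "('k, 'b) module"
begin

abbreviation "F \<equiv> free_pairs K A B"
abbreviation "N \<equiv> tensor_relations K A B"
abbreviation "T \<equiv> tensor_space K A B"
abbreviation "g \<equiv> free_gen K :: 'a \<times> 'b \<Rightarrow> 'a \<times> 'b \<Rightarrow> 'k"

sublocale F: module K F
  by (rule free_space_module) (rule A.is_cring)

lemma gen_closed: "a \<in> carrier A \<Longrightarrow> b \<in> carrier B \<Longrightarrow> g (a, b) \<in> carrier F"
  by (simp add: free_gen_carrier A.is_cring)

lemma relations_submodule: "submodule N K F"
  unfolding tensor_relations_def Let_def
  by (rule lin_span_submodule[OF F.module_axioms])
    (auto intro!: F.minus_closed F.a_closed F.smult_closed gen_closed)

sublocale N: abelian_subgroup N F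
  using relations_submodule
  by (intro abelian_subgroupI3 additive_subgroup.intro F.abelian_group_axioms)
    (rule submodule.axioms(1))

text \<open>For a relation \<open>m\<close>, scaling \<open>m \<oplus> \<phi>\<close> by
  \<open>c\<close> yields a multiple of \<open>m\<close>, again a relation, plus the multiple of
  \<open>\<phi>\<close>; the copy of \<open>N\<close> added in the definition absorbs the former.
  Conversely, \<open>\<phi>\<close> lies in its own coset.\<close>

lemma smult_coset:
  assumes c: "c \<in> carrier K" and \<phi>: "\<phi> \<in> carrier F"
  shows "c \<odot>\<^bsub>T\<^esub> (N +>\<^bsub>F\<^esub> \<phi>) = N +>\<^bsub>F\<^esub> (c \<odot>\<^bsub>F\<^esub> \<phi>)"
proof -
  have "N <+>\<^bsub>F\<^esub> ((\<lambda>\<phi>. c \<odot>\<^bsub>F\<^esub> \<phi>) ` (N +>\<^bsub>F\<^esub> \<phi>)) = N +>\<^bsub>F\<^esub> (c \<odot>\<^bsub>F\<^esub> \<phi>)"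
  proof (intro equalityI subsetI)
    fix x assume "x \<in> N <+>\<^bsub>F\<^esub> ((\<lambda>\<phi>. c \<odot>\<^bsub>F\<^esub> \<phi>) ` (N +>\<^bsub>F\<^esub> \<phi>))"
    then obtain n m where n: "n \<in> N" "m \<in> N" and x: "x = n \<oplus>\<^bsub>F\<^esub> c \<odot>\<^bsub>F\<^esub> (m \<oplus>\<^bsub>F\<^esub> \<phi>)"
      unfolding set_add_def' a_r_coset_def' by auto
    have carr: "n \<in> carrier F" "m \<in> carrier F" using n N.a_subset by auto
    have "x = (n \<oplus>\<^bsub>F\<^esub> c \<odot>\<^bsub>F\<^esub> m) \<oplus>\<^bsub>F\<^esub> c \<odot>\<^bsub>F\<^esub> \<phi>"
      using c \<phi> carr by (simp add: x F.smult_r_distr F.a_assoc)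
    moreover have "n \<oplus>\<^bsub>F\<^esub> c \<odot>\<^bsub>F\<^esub> m \<in> N"
      using n c relations_submodule by (intro N.a_closed submodule.smult_closed)
    ultimately show "x \<in> N +>\<^bsub>F\<^esub> (c \<odot>\<^bsub>F\<^esub> \<phi>)" unfolding a_r_coset_def' by auto
  next
    fix x assume "x \<in> N +>\<^bsub>F\<^esub> (c \<odot>\<^bsub>F\<^esub> \<phi>)"
    then obtain n where n: "n \<in> N" "x = n \<oplus>\<^bsub>F\<^esub> c \<odot>\<^bsub>F\<^esub> \<phi>" unfolding a_r_coset_def' by auto
    moreover have "\<phi> \<in> N +>\<^bsub>F\<^esub> \<phi>" by (rule N.a_rcos_self[OF \<phi>])
    ultimately show "x \<in> N <+>\<^bsub>F\<^esub> ((\<lambda>\<phi>. c \<odot>\<^bsub>F\<^esub> \<phi>) ` (N +>\<^bsub>F\<^esub> \<phi>))"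
      unfolding set_add_def' by auto
  qed
  then show ?thesis by (simp add: tensor_space_def Let_def)
qed

lemma add_coset:
  assumes "\<phi> \<in> carrier F" "\<psi> \<in> carrier F"
  shows "(N +>\<^bsub>F\<^esub> \<phi>) \<oplus>\<^bsub>T\<^esub> (N +>\<^bsub>F\<^esub> \<psi>) = N +>\<^bsub>F\<^esub> (\<phi> \<oplus>\<^bsub>F\<^esub> \<psi>)"
  using N.a_rcos_sum[OF assms] by (simp add: tensor_space_def Let_def)

lemma coset_closed: "\<phi> \<in> carrier F \<Longrightarrow> N +>\<^bsub>F\<^esub> \<phi> \<in> carrier T"
  using F.a_rcosetsI[OF N.a_subset] by (simp add: tensor_space_def Let_def)

lemma tensorE:
  assumes "t \<in> carrier T"
  obtains \<phi> where "\<phi> \<in> carrier F" "t = N +>\<^bsub>F\<^esub> \<phi>"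
  using assms by (auto simp: tensor_space_def Let_def A_RCOSETS_def')

lemma tensor_space_module: "module K T"
proof (rule moduleI[OF A.is_cring])
  have zero: "\<zero>\<^bsub>T\<^esub> = N +>\<^bsub>F\<^esub> \<zero>\<^bsub>F\<^esub>"
    using F.a_coset_add_zero[OF N.a_subset] by (simp add: tensor_space_def Let_def)
  show "abelian_group T"
  proof (rule abelian_groupI)
    fix t assume "t \<in> carrier T"
    then obtain \<phi> where \<phi>: "\<phi> \<in> carrier F" "t = N +>\<^bsub>F\<^esub> \<phi>" by (rule tensorE)
    then have "(N +>\<^bsub>F\<^esub> \<ominus>\<^bsub>F\<^esub> \<phi>) \<oplus>\<^bsub>T\<^esub> t = \<zero>\<^bsub>T\<^esub>"
      by (simp add: add_coset zero F.l_neg)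
    then show "\<exists>s\<in>carrier T. s \<oplus>\<^bsub>T\<^esub> t = \<zero>\<^bsub>T\<^esub>"
      using \<phi> coset_closed by blast
  qed (auto elim!: tensorE simp: zero add_coset F.a_ac intro!: coset_closed)
qed (auto elim!: tensorE simp: smult_coset add_coset F.smult_l_distr F.smult_r_distr F.smult_assoc1
    intro!: coset_closed)

sublocale T: module K T by (rule tensor_space_module)

lemma coset_linear: "(+>\<^bsub>F\<^esub>) N \<in> linear_maps K F T"
  by (simp add: linear_maps_def coset_closed add_coset smult_coset)

lemma tens_closed: "a \<in> carrier A \<Longrightarrow> b \<in> carrier B \<Longrightarrow> tens K A B a b \<in> carrier T"
  unfolding tens_def by (intro coset_closed gen_closed)

text \<open>Each clause asserts that two cosets agree, and the difference of their representatives
  is one of the four kinds of spanning relations.\<close>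

lemma tens_bilinear: "tens K A B \<in> bilinear_maps K A B T"
proof -
  have eq: "N +>\<^bsub>F\<^esub> \<phi> = N +>\<^bsub>F\<^esub> \<psi>" if "\<phi> \<ominus>\<^bsub>F\<^esub> \<psi> \<in> N" "\<phi> \<in> carrier F" "\<psi> \<in> carrier F" for \<phi> \<psi>
    using that F.a_coset_join2[OF _ N.a_subgroup that(1)] N.a_subset
    by (intro F.a_coset_add_inv1) (auto simp: a_minus_def)
  have "N +>\<^bsub>F\<^esub> g (a \<oplus>\<^bsub>A\<^esub> a', b) = N +>\<^bsub>F\<^esub> (g (a, b) \<oplus>\<^bsub>F\<^esub> g (a', b))"
    if "a \<in> carrier A" "a' \<in> carrier A" "b \<in> carrier B" for a a' b
    using that unfolding tensor_relations_def Let_def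
    by (intro eq[unfolded tensor_relations_def Let_def] lin_span_base[THEN subsetD])
      (blast | auto intro: gen_closed)+
  moreover have "N +>\<^bsub>F\<^esub> g (a, b \<oplus>\<^bsub>B\<^esub> b') = N +>\<^bsub>F\<^esub> (g (a, b) \<oplus>\<^bsub>F\<^esub> g (a, b'))"
    if "a \<in> carrier A" "b \<in> carrier B" "b' \<in> carrier B" for a b b'
    using that unfolding tensor_relations_def Let_def
    by (intro eq[unfolded tensor_relations_def Let_def] lin_span_base[THEN subsetD])
      (blast | auto intro: gen_closed)+
  moreover have "N +>\<^bsub>F\<^esub> g (c \<odot>\<^bsub>A\<^esub> a, b) = N +>\<^bsub>F\<^esub> (c \<odot>\<^bsub>F\<^esub> g (a, b))"
    if "c \<in> carrier K" "a \<in> carrier A" "b \<in> carrier B" for c a b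
    using that unfolding tensor_relations_def Let_def
    by (intro eq[unfolded tensor_relations_def Let_def] lin_span_base[THEN subsetD])
      (blast | auto intro: gen_closed)+
  moreover have "N +>\<^bsub>F\<^esub> g (a, c \<odot>\<^bsub>B\<^esub> b) = N +>\<^bsub>F\<^esub> (c \<odot>\<^bsub>F\<^esub> g (a, b))"
    if "c \<in> carrier K" "a \<in> carrier A" "b \<in> carrier B" for c a b
    using that unfolding tensor_relations_def Let_def
    by (intro eq[unfolded tensor_relations_def Let_def] lin_span_base[THEN subsetD])
      (blast | auto intro: gen_closed)+
  ultimately show ?thesis
    unfolding bilinear_maps_def linear_maps_def
    by (simp add: tens_closed tens_def[abs_def] add_coset smult_coset gen_closed coset_closed)
qed

text \<open>A bilinear \<open>f\<close> evaluates every spanning relation to zero, hence all of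
  \<open>N\<close>. So all members of a coset have the same value, whichever of them
  \<open>SOME\<close> picks: the lift is well defined.\<close>

lemma tensor_lift_coset:
  assumes "module K C" and f: "f \<in> bilinear_maps K A B C" and \<phi>: "\<phi> \<in> carrier F"
  shows "tensor_lift K C f (N +>\<^bsub>F\<^esub> \<phi>) = free_eval K C (\<lambda>p. f (fst p) (snd p)) \<phi>"
proof -
  interpret C: module K C by fact
  let ?h = "\<lambda>p. f (fst p) (snd p)"
  let ?ev = "free_eval K C ?h"
  note bil = bilinear_map_simps[OF f]
  have lin: "?ev \<in> linear_maps K F C"
    by (rule free_eval_linear[OF assms(1)]) (auto intro: bil)
  note lin' = linear_mapsD[OF lin] linear_map_minus[OF F.module_axioms assms(1) lin]
  have ev_gen: "?ev (g (a, b)) = f a b" if "a \<in> carrier A" "b \<in> carrier B" for a b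
    using free_eval_gen[OF assms(1), of ?h "(a, b)"] bil that by simp
  \<comment> \<open>The kernel of the evaluation. As it is a submodule, minimality of the span
    reduces \<open>N \<subseteq> ?H\<close> to the spanning relations.\<close>
  let ?H = "{\<phi> \<in> carrier F. ?ev \<phi> = \<zero>\<^bsub>C\<^esub>}"
  have sub: "submodule ?H K F"
    by (rule submodule_smultI[OF F.module_axioms])
      (auto simp: lin' linear_map_zero[OF F.module_axioms assms(1) lin])
  have self: "x \<ominus>\<^bsub>C\<^esub> x = \<zero>\<^bsub>C\<^esub>" if "x \<in> carrier C" for x
    using that by (simp add: a_minus_def C.r_neg)
  have "N \<subseteq> ?H"
    unfolding tensor_relations_def Let_def
    by (rule lin_span_minimal[OF sub])
      (auto simp: lin' ev_gen bil self gen_closed intro!: F.minus_closed F.a_closed F.smult_closed)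
  have "?ev \<psi> = ?ev \<phi>" if "\<psi> \<in> N +>\<^bsub>F\<^esub> \<phi>" for \<psi>
  proof -
    obtain n where n: "n \<in> N" "\<psi> = n \<oplus>\<^bsub>F\<^esub> \<phi>" using \<open>\<psi> \<in> _\<close> by (auto simp: a_r_coset_def')
    then show ?thesis using \<open>N \<subseteq> ?H\<close> \<phi> lin'(1)[OF \<phi>] by (auto simp: lin')
  qed
  moreover have "(SOME \<psi>. \<psi> \<in> N +>\<^bsub>F\<^esub> \<phi>) \<in> N +>\<^bsub>F\<^esub> \<phi>"
    using N.a_rcos_self[OF \<phi>] by (rule someI[where P = "\<lambda>\<psi>. \<psi> \<in> N +>\<^bsub>F\<^esub> \<phi>"])
  ultimately show ?thesis unfolding tensor_lift_def Let_def free_eval_def[symmetric] by blast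
qed

lemma tensor_lift_tens:
  assumes "module K C" and f: "f \<in> bilinear_maps K A B C" and "a \<in> carrier A" "b \<in> carrier B"
  shows "tensor_lift K C f (tens K A B a b) = f a b"
  using tensor_lift_coset[OF assms(1,2) gen_closed[OF assms(3,4)]]
    free_eval_gen[OF assms(1), of "\<lambda>p. f (fst p) (snd p)" "(a, b)"]
    bilinear_map_simps(1)[OF assms(2-4)]
  by (simp add: tens_def)

text \<open>This concerns the very representative that \<open>tensor_lift\<close> picks, so that
  lifts at \<open>t\<close> of arbitrary functions can be treated as concrete finite sums.\<close>

lemma tensor_representative:
  assumes "t \<in> carrier T"
  defines "\<phi> \<equiv> (SOME \<phi>. \<phi> \<in> t)"
  shows "\<phi> p \<in> carrier K" "finite {p. \<phi> p \<noteq> \<zero>\<^bsub>K\<^esub>}"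
    "{p. \<phi> p \<noteq> \<zero>\<^bsub>K\<^esub>} \<subseteq> carrier A \<times> carrier B"
    "(\<Oplus>\<^bsub>T\<^esub>p\<in>{p. \<phi> p \<noteq> \<zero>\<^bsub>K\<^esub>}. \<phi> p \<odot>\<^bsub>T\<^esub> tens K A B (fst p) (snd p)) = t"
proof -
  obtain \<psi> where \<psi>: "\<psi> \<in> carrier F" "t = N +>\<^bsub>F\<^esub> \<psi>" using assms(1) by (rule tensorE)
  have "\<psi> \<in> t" using \<psi> N.a_rcos_self by simp
  then have "\<phi> \<in> t" unfolding \<phi>_def by (rule someI[where P = "\<lambda>\<phi>. \<phi> \<in> t"])
  then have \<phi>: "\<phi> \<in> carrier F" and t: "t = N +>\<^bsub>F\<^esub> \<phi>"
    using \<psi> F.a_r_coset_subset_G[OF N.a_subset] F.a_repr_independence[OF _ _ N.a_subgroup] by auto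
  let ?S = "{p. \<phi> p \<noteq> \<zero>\<^bsub>K\<^esub>}"
  show S: "\<phi> p \<in> carrier K" "finite ?S" "?S \<subseteq> carrier A \<times> carrier B" for p
    using \<phi> by (auto simp: free_space_def)
  have "N +>\<^bsub>F\<^esub> (\<Oplus>\<^bsub>F\<^esub>p\<in>?S. \<phi> p \<odot>\<^bsub>F\<^esub> g p) = (\<Oplus>\<^bsub>T\<^esub>p\<in>?S. \<phi> p \<odot>\<^bsub>T\<^esub> (N +>\<^bsub>F\<^esub> g p))"
    using S by (intro linear_map_lincomb[OF F.module_axioms T.module_axioms coset_linear])
      (auto intro!: gen_closed)
  then show "(\<Oplus>\<^bsub>T\<^esub>p\<in>?S. \<phi> p \<odot>\<^bsub>T\<^esub> tens K A B (fst p) (snd p)) = t"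
    using free_space_expand[OF A.is_cring \<phi>] by (simp add: t tens_def)
qed

end

section \<open>Products and lifts evaluated on a fixed representative\<close>

lemma tensor_algebra_simps [simp]:
  "carrier (tensor_algebra K A B) = carrier (tensor_space K A B)"
  "s \<otimes>\<^bsub>tensor_algebra K A B\<^esub> t = tensor_lift K (tensor_space K A B) (\<lambda>a b.
     tensor_lift K (tensor_space K A B) (\<lambda>a' b'. tens K A B (a \<otimes>\<^bsub>A\<^esub> a') (b \<otimes>\<^bsub>B\<^esub> b')) t) s"
  by (simp_all add: tensor_algebra_def Let_def)

text \<open>Both lifts choose their representative from \<open>t\<close> alone, hence the same one,
  and \<open>h\<close> passes through a single finite sum. The integrand may thus be any function
  into \<open>C\<close>, as \<open>linked_mult\<close> requires.\<close>

lemma tensor_lift_linear: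
  assumes "module K A" "module K B" "module K C" "module K D" and h: "h \<in> linear_maps K C D"
    and t: "t \<in> carrier (tensor_space K A B)"
    and f: "\<And>a b. a \<in> carrier A \<Longrightarrow> b \<in> carrier B \<Longrightarrow> f a b \<in> carrier C"
  shows "h (tensor_lift K C f t) = tensor_lift K D (\<lambda>a b. h (f a b)) t"
proof -
  interpret tensor_factors K A B using assms by (intro tensor_factors.intro)
  define \<phi> where "\<phi> = (SOME \<phi>. \<phi> \<in> t)"
  note \<phi> = tensor_representative[OF t, folded \<phi>_def]
  show ?thesis
    unfolding tensor_lift_def Let_def \<phi>_def[symmetric]
    using \<phi>(1-3) f by (intro linear_map_lincomb[OF assms(3,4) h]) auto
qed

lemma tensor_lift_cong:
  assumes "module K A" "module K B" "module K C" and t: "t \<in> carrier (tensor_space K A B)"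
    and f: "\<And>a b. a \<in> carrier A \<Longrightarrow> b \<in> carrier B \<Longrightarrow> f a b \<in> carrier C"
    and eq: "\<And>a b. a \<in> carrier A \<Longrightarrow> b \<in> carrier B \<Longrightarrow> f a b = f' a b"
  shows "tensor_lift K C f t = tensor_lift K C f' t"
proof -
  interpret tensor_factors K A B using assms by (intro tensor_factors.intro)
  interpret C: module K C by fact
  define \<phi> where "\<phi> = (SOME \<phi>. \<phi> \<in> t)"
  note \<phi> = tensor_representative[OF t, folded \<phi>_def]
  show ?thesis
    unfolding tensor_lift_def Let_def \<phi>_def[symmetric]
    using \<phi>(1-3) f eq by (intro C.add.finprod_cong') (auto simp: subset_iff)
qed

lemma tensor_lift_closed:
  assumes "module K A" "module K B" "module K C" and t: "t \<in> carrier (tensor_space K A B)"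
    and f: "\<And>a b. a \<in> carrier A \<Longrightarrow> b \<in> carrier B \<Longrightarrow> f a b \<in> carrier C"
  shows "tensor_lift K C f t \<in> carrier C"
proof -
  interpret tensor_factors K A B using assms by (intro tensor_factors.intro)
  interpret C: module K C by fact
  define \<phi> where "\<phi> = (SOME \<phi>. \<phi> \<in> t)"
  note \<phi> = tensor_representative[OF t, folded \<phi>_def]
  show ?thesis
    unfolding tensor_lift_def Let_def \<phi>_def[symmetric]
    using \<phi>(1-3) f by (intro C.finsum_closed) (auto simp: subset_iff)
qed

section \<open>Local units\<close>

definition has_local_units :: "('k, 'a) module \<Rightarrow> bool" where
  "has_local_units A \<longleftrightarrow> (\<forall>X. finite X \<and> X \<subseteq> carrier A \<longrightarrow>
     (\<exists>e\<in>carrier A. \<forall>a\<in>X. a \<otimes>\<^bsub>A\<^esub> e = a \<and> e \<otimes>\<^bsub>A\<^esub> a = a))"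

lemma local_unitE:
  assumes "has_local_units A" "finite X" "X \<subseteq> carrier A"
  obtains e where "e \<in> carrier A" "\<forall>a\<in>X. a \<otimes>\<^bsub>A\<^esub> e = a" "\<forall>a\<in>X. e \<otimes>\<^bsub>A\<^esub> a = a"
proof -
  have "\<exists>e\<in>carrier A. \<forall>a\<in>X. a \<otimes>\<^bsub>A\<^esub> e = a \<and> e \<otimes>\<^bsub>A\<^esub> a = a"
    using assms(1)[unfolded has_local_units_def, rule_format] assms(2,3) by simp
  then show ?thesis using that by blast
qed

text \<open>\<open>X\<close> consists of all factors occurring in a finite representative of
  \<open>t\<close>. A set is returned rather than one unit, so that several tensors can share a unit
  chosen for the union of their sets.\<close>

lemma tensor_local_unit:
  assumes "nonunital_algebra K A" and t: "t \<in> carrier (tensor_space K A A)"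
  obtains X where "finite X" "X \<subseteq> carrier A"
    "\<And>e. e \<in> carrier A \<Longrightarrow> \<forall>a\<in>X. a \<otimes>\<^bsub>A\<^esub> e = a \<Longrightarrow> t \<otimes>\<^bsub>tensor_algebra K A A\<^esub> tens K A A e e = t"
proof -
  interpret A: nonunital_algebra K A by fact
  interpret tensor_factors K A A by (intro tensor_factors.intro A.module_axioms)
  define \<phi> where "\<phi> = (SOME \<phi>. \<phi> \<in> t)"
  note \<phi> = tensor_representative[OF t, folded \<phi>_def]
  let ?S = "{p. \<phi> p \<noteq> \<zero>\<^bsub>K\<^esub>}"
  show ?thesis
  proof (rule that[of "fst ` ?S \<union> snd ` ?S"])
    fix e assume e: "e \<in> carrier A" "\<forall>a\<in>fst ` ?S \<union> snd ` ?S. a \<otimes>\<^bsub>A\<^esub> e = a"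
    have e_unit: "a \<otimes>\<^bsub>A\<^esub> e = a" "b \<otimes>\<^bsub>A\<^esub> e = b" if "\<phi> (a, b) \<noteq> \<zero>\<^bsub>K\<^esub>" for a b
      using e(2) that by force+
    \<comment> \<open>At the pure tensor of \<open>e\<close> with itself, the universal property
      evaluates the lift of a bilinear function.\<close>
    have inner: "tensor_lift K T (\<lambda>a' b'. tens K A A (a \<otimes>\<^bsub>A\<^esub> a') (b \<otimes>\<^bsub>A\<^esub> b')) (tens K A A e e)
        = tens K A A (a \<otimes>\<^bsub>A\<^esub> e) (b \<otimes>\<^bsub>A\<^esub> e)" if ab: "a \<in> carrier A" "b \<in> carrier A" for a b
    proof (rule tensor_lift_tens[OF T.module_axioms _ e(1) e(1)])
      show "(\<lambda>a' b'. tens K A A (a \<otimes>\<^bsub>A\<^esub> a') (b \<otimes>\<^bsub>A\<^esub> b')) \<in> bilinear_maps K A A T"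
        using ab unfolding bilinear_maps_def linear_maps_def
        by (auto simp: A.mult_closed A.mult_r_distr A.smult_mult_r
            bilinear_map_simps[OF tens_bilinear])
    qed
    \<comment> \<open>The outer lift is the sum over the chosen representative. Applying
      \<open>inner\<close> and the unit laws to each term leaves the sum that represents
      \<open>t\<close>.\<close>
    show "t \<otimes>\<^bsub>tensor_algebra K A A\<^esub> tens K A A e e = t"
      unfolding tensor_algebra_simps
      unfolding tensor_lift_def[of K T _ t] Let_def \<phi>_def[symmetric]
      by (rule trans[OF T.add.finprod_cong' \<phi>(4)])
        (use \<phi>(1-3) in \<open>auto simp: subset_iff inner e_unit tens_closed\<close>)
  qed (use \<phi> in auto)
qed

text \<open>This makes the description in \<^const>\<open>mult_elem\<close> meaningful for the algebra \<open>A \<otimes> A\<close>.\<close>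

lemma mult_embed_tensor_inj:
  assumes "nonunital_algebra K A" "has_local_units A"
  shows "inj_on (mult_embed (tensor_algebra K A A)) (carrier (tensor_algebra K A A))"
proof (rule inj_onI, unfold tensor_algebra_simps(1))
  interpret A: nonunital_algebra K A by fact
  interpret tensor_factors K A A by (intro tensor_factors.intro A.module_axioms)
  fix s t assume s: "s \<in> carrier T" and t: "t \<in> carrier T"
    and eq: "mult_embed (tensor_algebra K A A) s = mult_embed (tensor_algebra K A A) t"
  obtain X where X: "finite X" "X \<subseteq> carrier A" "\<And>e. e \<in> carrier A \<Longrightarrow> \<forall>a\<in>X. a \<otimes>\<^bsub>A\<^esub> e = a \<Longrightarrow>
      s \<otimes>\<^bsub>tensor_algebra K A A\<^esub> tens K A A e e = s"
    using tensor_local_unit[OF assms(1) s] by blast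
  obtain Y where Y: "finite Y" "Y \<subseteq> carrier A" "\<And>e. e \<in> carrier A \<Longrightarrow> \<forall>a\<in>Y. a \<otimes>\<^bsub>A\<^esub> e = a \<Longrightarrow>
      t \<otimes>\<^bsub>tensor_algebra K A A\<^esub> tens K A A e e = t"
    using tensor_local_unit[OF assms(1) t] by blast
  obtain e where e: "e \<in> carrier A" "\<forall>a\<in>X \<union> Y. a \<otimes>\<^bsub>A\<^esub> e = a"
    using local_unitE[OF assms(2), of "X \<union> Y"] X(1,2) Y(1,2) by (metis Un_least finite_UnI)
  \<comment> \<open>Equal multipliers agree at the tensor of \<open>e\<close> with itself; since
    \<open>e\<close> is a unit for the factors of both tensors, this evaluation recovers
    \<open>s\<close> and \<open>t\<close>.\<close>
  have "s \<otimes>\<^bsub>tensor_algebra K A A\<^esub> tens K A A e e = t \<otimes>\<^bsub>tensor_algebra K A A\<^esub> tens K A A e e"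
    using fun_cong[OF arg_cong[where f = fst, OF eq], of "tens K A A e e"] tens_closed[OF e(1) e(1)]
    by (simp add: mult_embed_def)
  then show "s = t" using X(3)[of e] Y(3)[of e] e by simp
qed

text \<open>\<open>cov_r2\<close> is a definite description. The axiom \<open>cov_r2_in\<close>
  gives existence and injectivity of the embedding gives uniqueness, so it denotes a genuine
  tensor.\<close>

lemma (in multiplier_hopf_algebra) cov_r2_closed:
  assumes "has_local_units A" "a \<in> carrier A" "b \<in> carrier A"
  shows "cov_r2 K A \<Delta> a b \<in> carrier (tensor_space K A A)"
proof -
  let ?TA = "tensor_algebra K A A"
  let ?m = "\<Delta> a \<otimes>\<^bsub>MAA K A\<^esub> leg2 K A b"
  obtain t where t: "t \<in> carrier ?TA" "mult_embed ?TA t = ?m"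
    using cov_r2_in[OF assms(2,3)] by auto
  have "mult_elem ?TA ?m = t"
    unfolding mult_elem_def
    using t mult_embed_tensor_inj[OF nonunital_algebra_axioms assms(1)]
    by (intro the_equality) (simp_all add: inj_on_def)
  then show ?thesis using t(1) by (simp add: cov_r2_def)
qed

section \<open>Enveloping actions\<close>

context enveloping_action
begin

lemma proj_hom: "\<pi> \<in> algebra_homs K R R"
  using proj unfolding symmetric_projection_def by blast

lemma proj_linear: "\<pi> \<in> linear_maps K R R"
  using proj_hom unfolding algebra_homs_def by blast

lemma proj_mult: "x \<in> carrier R \<Longrightarrow> y \<in> carrier R \<Longrightarrow> \<pi> (x \<otimes>\<^bsub>R\<^esub> y) = \<pi> x \<otimes>\<^bsub>R\<^esub> \<pi> y"
  using proj_hom unfolding algebra_homs_def by blast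

lemma theta_linear: "\<theta> \<in> linear_maps K L R"
  using theta_hom unfolding algebra_homs_def by blast

lemma theta_mult: "x \<in> carrier L \<Longrightarrow> y \<in> carrier L \<Longrightarrow> \<theta> (x \<otimes>\<^bsub>L\<^esub> y) = \<theta> x \<otimes>\<^bsub>R\<^esub> \<theta> y"
  using theta_hom unfolding algebra_homs_def by blast

lemmas act_simps = bilinear_map_simps[OF act_bilinear]
lemmas proj_simps = linear_mapsD[OF proj_linear]
lemmas theta_simps = linear_mapsD[OF theta_linear]

text \<open>An induction principle drawn from the spanning condition; it replaces computations with
  finite sums of generators.\<close>

lemma generated_induct:
  assumes "u \<in> carrier R" "submodule H K R"
    and "\<And>a x. a \<in> carrier A \<Longrightarrow> x \<in> carrier L \<Longrightarrow> act a (\<theta> x) \<in> H"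
  shows "u \<in> H"
proof -
  have "lin_span K R {act a (\<theta> x) | a x. a \<in> carrier A \<and> x \<in> carrier L} \<subseteq> H"
    by (rule lin_span_minimal[OF assms(2)]) (use assms(3) in blast)
  then show ?thesis using assms(1) generated by blast
qed

text \<open>On a generator \<open>act a (\<theta> x)\<close> the element \<open>e\<close> acts by
  multiplying \<open>a\<close> from the left, so \<open>{a}\<close> serves; sums take unions. Again
  a set is returned so that units can be shared.\<close>

lemma act_local_unit:
  assumes A: "nonunital_algebra K A" and u: "u \<in> carrier R"
  obtains X where "finite X" "X \<subseteq> carrier A"
    "\<And>e. e \<in> carrier A \<Longrightarrow> \<forall>a\<in>X. e \<otimes>\<^bsub>A\<^esub> a = a \<Longrightarrow> act e u = u"
proof -
  interpret A: nonunital_algebra K A by fact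
  let ?P = "\<lambda>u X. finite X \<and> X \<subseteq> carrier A \<and>
    (\<forall>e\<in>carrier A. (\<forall>a\<in>X. e \<otimes>\<^bsub>A\<^esub> a = a) \<longrightarrow> act e u = u)"
  let ?H = "{u \<in> carrier R. \<exists>X. ?P u X}"
  have "u \<in> ?H"
  proof (rule generated_induct[OF u])
    show "submodule ?H K R"
    proof (rule submodule_smultI[OF module_axioms])
      have "?P \<zero>\<^bsub>R\<^esub> {}"
        using act_simps(5)[of "\<zero>\<^bsub>K\<^esub>" _ "\<zero>\<^bsub>R\<^esub>"] by (auto simp: act_simps(1))
      then show "\<zero>\<^bsub>R\<^esub> \<in> ?H" by blast
    next
      fix u v assume "u \<in> ?H" "v \<in> ?H"
      then obtain X Y where "?P u X" "?P v Y" and uv: "u \<in> carrier R" "v \<in> carrier R" by blast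
      then have "?P (u \<oplus>\<^bsub>R\<^esub> v) (X \<union> Y)" by (auto simp: act_simps)
      with uv show "u \<oplus>\<^bsub>R\<^esub> v \<in> ?H" by blast
    next
      fix c u assume c: "c \<in> carrier K" and "u \<in> ?H"
      then obtain X where "?P u X" and u: "u \<in> carrier R" by blast
      then have "?P (c \<odot>\<^bsub>R\<^esub> u) X" using c by (auto simp: act_simps)
      with u c show "c \<odot>\<^bsub>R\<^esub> u \<in> ?H" by blast
    qed auto
    fix a x assume a: "a \<in> carrier A" and x: "x \<in> carrier L"
    then have "?P (act a (\<theta> x)) {a}" by (auto simp: act_act theta_simps)
    moreover have "act a (\<theta> x) \<in> carrier R" using a x by (simp add: act_simps theta_simps)
    ultimately show "act a (\<theta> x) \<in> ?H" by blast
  qed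
  then show ?thesis using that by blast
qed

end

lemma (in minimal_enveloping_action) proj_act_zero_imp_zero:
  assumes A: "nonunital_algebra K A" "has_local_units A"
    and u: "u \<in> carrier R" "\<And>b. b \<in> carrier A \<Longrightarrow> \<pi> (act b u) = \<zero>\<^bsub>R\<^esub>"
  shows "u = \<zero>\<^bsub>R\<^esub>"
proof -
  interpret A: nonunital_algebra K A by fact
  \<comment> \<open>All elements with vanishing family are collected at once. They are stable under
    the action because acting by \<open>a\<close> and then by \<open>b\<close> is acting by the
    product \<open>b a\<close>.\<close>
  let ?M = "{u \<in> carrier R. \<forall>b\<in>carrier A. \<pi> (act b u) = \<zero>\<^bsub>R\<^esub>}"
  note zero = linear_map_zero[OF module_axioms module_axioms]
  have act_zero: "act b \<zero>\<^bsub>R\<^esub> = \<zero>\<^bsub>R\<^esub>" if "b \<in> carrier A" for b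
    using zero[of "act b"] act_bilinear that unfolding bilinear_maps_def by blast
  have "submodule ?M K R"
    by (rule submodule_smultI[OF module_axioms])
      (auto simp: act_zero zero[OF proj_linear] act_simps proj_simps)
  moreover have "act a m \<in> ?M" if "a \<in> carrier A" "m \<in> ?M" for a m
    using that by (auto simp: act_simps act_act A.mult_closed)
  moreover have "\<pi> ` ?M = {\<zero>\<^bsub>R\<^esub>}"
  proof (intro equalityI image_subsetI)
    fix m assume m: "m \<in> ?M"
    obtain X where X: "finite X" "X \<subseteq> carrier A"
      "\<And>e. e \<in> carrier A \<Longrightarrow> \<forall>a\<in>X. e \<otimes>\<^bsub>A\<^esub> a = a \<Longrightarrow> act e m = m"
      using act_local_unit[OF A(1), of m] m by blast
    obtain e where e: "e \<in> carrier A" "\<forall>a\<in>X. e \<otimes>\<^bsub>A\<^esub> a = a"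
      using local_unitE[OF A(2) X(1,2)] by metis
    then have "act e m = m" by (rule X(3))
    moreover have "\<pi> (act e m) = \<zero>\<^bsub>R\<^esub>" using m e by blast
    ultimately show "\<pi> m \<in> {\<zero>\<^bsub>R\<^esub>}" by simp
  next
    \<comment> \<open>\<open>minimal\<close> asks for an equation of sets, so zero must be attained
      as well.\<close>
    have "\<zero>\<^bsub>R\<^esub> \<in> \<pi> ` ?M"
      by (rule image_eqI[where x = "\<zero>\<^bsub>R\<^esub>"]) (simp_all add: act_zero zero[OF proj_linear])
    then show "{\<zero>\<^bsub>R\<^esub>} \<subseteq> \<pi> ` ?M" by simp
  qed
  ultimately have "?M = {\<zero>\<^bsub>R\<^esub>}" by (rule minimal)
  then show ?thesis using u by blast
qed

section \<open>The linking relation between two minimal enveloping actions\<close>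

locale enveloping_pair =
  E1: minimal_enveloping_action K A \<Delta> L pact R\<^sub>1 act\<^sub>1 \<theta>\<^sub>1 \<pi>\<^sub>1 +
  E2: minimal_enveloping_action K A \<Delta> L pact R\<^sub>2 act\<^sub>2 \<theta>\<^sub>2 \<pi>\<^sub>2 +
  A: multiplier_hopf_algebra K A \<Delta> + L: nonunital_algebra K L
  for K :: "'k ring" and A :: "('k, 'a) module" and \<Delta> :: "('k, 'a) comult"
    and L :: "('k, 'l) module" and pact :: "'a \<Rightarrow> 'l \<Rightarrow> 'l"
    and R\<^sub>1 :: "('k, 'r) module" and act\<^sub>1 :: "'a \<Rightarrow> 'r \<Rightarrow> 'r"
    and \<theta>\<^sub>1 :: "'l \<Rightarrow> 'r" and \<pi>\<^sub>1 :: "'r \<Rightarrow> 'r"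
    and R\<^sub>2 :: "('k, 's) module" and act\<^sub>2 :: "'a \<Rightarrow> 's \<Rightarrow> 's"
    and \<theta>\<^sub>2 :: "'l \<Rightarrow> 's" and \<pi>\<^sub>2 :: "'s \<Rightarrow> 's" +
  assumes local_units: "has_local_units A"
    and pact_closed: "a \<in> carrier A \<Longrightarrow> x \<in> carrier L \<Longrightarrow> pact a x \<in> carrier L"
begin

text \<open>A relation avoids showing beforehand that an assignment on generators is independent of
  how an element is written as a sum; totality and uniqueness follow separately. Both sides enter
  alike, which later permits exchanging them.\<close>

definition linked :: "'r \<Rightarrow> 's \<Rightarrow> bool" where
  "linked u v \<longleftrightarrow> u \<in> carrier R\<^sub>1 \<and> v \<in> carrier R\<^sub>2 \<and>
     (\<forall>b\<in>carrier A. \<exists>x\<in>carrier L. \<theta>\<^sub>1 x = \<pi>\<^sub>1 (act\<^sub>1 b u) \<and> \<theta>\<^sub>2 x = \<pi>\<^sub>2 (act\<^sub>2 b v))"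

lemma linked_closed:
  assumes "linked u v"
  shows "u \<in> carrier R\<^sub>1" "v \<in> carrier R\<^sub>2"
  using assms by (auto simp: linked_def)

text \<open>Choice bundles the elements of \<open>L\<close> into one coordinate function. Its
  linearity is not recorded, as lifts of arbitrary functions are available for products.\<close>

lemma linked_coord:
  assumes "linked u v"
  obtains x where "\<And>b. b \<in> carrier A \<Longrightarrow> x b \<in> carrier L"
    "\<And>b. b \<in> carrier A \<Longrightarrow> \<pi>\<^sub>1 (act\<^sub>1 b u) = \<theta>\<^sub>1 (x b)"
    "\<And>b. b \<in> carrier A \<Longrightarrow> \<pi>\<^sub>2 (act\<^sub>2 b v) = \<theta>\<^sub>2 (x b)"
proof -
  have "\<forall>b\<in>carrier A. \<exists>x. x \<in> carrier L \<and> \<theta>\<^sub>1 x = \<pi>\<^sub>1 (act\<^sub>1 b u) \<and> \<theta>\<^sub>2 x = \<pi>\<^sub>2 (act\<^sub>2 b v)"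
    using assms unfolding linked_def by blast
  from bchoice[OF this] obtain x where "\<forall>b\<in>carrier A. x b \<in> carrier L \<and>
      \<theta>\<^sub>1 (x b) = \<pi>\<^sub>1 (act\<^sub>1 b u) \<and> \<theta>\<^sub>2 (x b) = \<pi>\<^sub>2 (act\<^sub>2 b v)" ..
  then show ?thesis by (intro that[of x]) simp_all
qed

lemma linkedI:
  assumes "u \<in> carrier R\<^sub>1" "v \<in> carrier R\<^sub>2"
    and "\<And>b. b \<in> carrier A \<Longrightarrow> x b \<in> carrier L"
    and "\<And>b. b \<in> carrier A \<Longrightarrow> \<pi>\<^sub>1 (act\<^sub>1 b u) = \<theta>\<^sub>1 (x b)"
    and "\<And>b. b \<in> carrier A \<Longrightarrow> \<pi>\<^sub>2 (act\<^sub>2 b v) = \<theta>\<^sub>2 (x b)"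
  shows "linked u v"
  unfolding linked_def using assms by (intro conjI ballI bexI[where x = "x _"]) simp_all

text \<open>Associativity merges the two actions into one by the product \<open>b a\<close>, and
  \<open>theta_act\<close> then yields the same element of \<open>L\<close> on both sides.\<close>

lemma linked_gen:
  assumes "a \<in> carrier A" "y \<in> carrier L"
  shows "linked (act\<^sub>1 a (\<theta>\<^sub>1 y)) (act\<^sub>2 a (\<theta>\<^sub>2 y))"
  using assms
  by (intro linkedI[where x = "\<lambda>b. pact (b \<otimes>\<^bsub>A\<^esub> a) y"])
    (auto simp: E1.act_act E2.act_act E1.theta_act E2.theta_act E1.act_simps E2.act_simps
      E1.theta_simps E2.theta_simps pact_closed A.mult_closed)

lemma linked_add:
  assumes uv: "linked u v" and uv': "linked u' v'"
  shows "linked (u \<oplus>\<^bsub>R\<^sub>1\<^esub> u') (v \<oplus>\<^bsub>R\<^sub>2\<^esub> v')"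
proof -
  note carr = linked_closed[OF uv] linked_closed[OF uv']
  obtain x where x: "\<And>b. b \<in> carrier A \<Longrightarrow> x b \<in> carrier L"
    "\<And>b. b \<in> carrier A \<Longrightarrow> \<pi>\<^sub>1 (act\<^sub>1 b u) = \<theta>\<^sub>1 (x b)"
    "\<And>b. b \<in> carrier A \<Longrightarrow> \<pi>\<^sub>2 (act\<^sub>2 b v) = \<theta>\<^sub>2 (x b)"
    using linked_coord[OF uv] by metis
  obtain x' where x': "\<And>b. b \<in> carrier A \<Longrightarrow> x' b \<in> carrier L"
    "\<And>b. b \<in> carrier A \<Longrightarrow> \<pi>\<^sub>1 (act\<^sub>1 b u') = \<theta>\<^sub>1 (x' b)"
    "\<And>b. b \<in> carrier A \<Longrightarrow> \<pi>\<^sub>2 (act\<^sub>2 b v') = \<theta>\<^sub>2 (x' b)"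
    using linked_coord[OF uv'] by metis
  show ?thesis
    using carr x x'
    by (intro linkedI[where x = "\<lambda>b. x b \<oplus>\<^bsub>L\<^esub> x' b"])
      (auto simp: E1.act_simps E2.act_simps E1.proj_simps E2.proj_simps E1.theta_simps E2.theta_simps)
qed

lemma linked_smult:
  assumes c: "c \<in> carrier K" and uv: "linked u v"
  shows "linked (c \<odot>\<^bsub>R\<^sub>1\<^esub> u) (c \<odot>\<^bsub>R\<^sub>2\<^esub> v)"
proof -
  note carr = linked_closed[OF uv]
  obtain x where x: "\<And>b. b \<in> carrier A \<Longrightarrow> x b \<in> carrier L"
    "\<And>b. b \<in> carrier A \<Longrightarrow> \<pi>\<^sub>1 (act\<^sub>1 b u) = \<theta>\<^sub>1 (x b)"
    "\<And>b. b \<in> carrier A \<Longrightarrow> \<pi>\<^sub>2 (act\<^sub>2 b v) = \<theta>\<^sub>2 (x b)"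
    using linked_coord[OF uv] by metis
  show ?thesis
    using carr c x
    by (intro linkedI[where x = "\<lambda>b. c \<odot>\<^bsub>L\<^esub> x b"])
      (auto simp: E1.act_simps E2.act_simps E1.proj_simps E2.proj_simps E1.theta_simps E2.theta_simps)
qed

lemma linked_act:
  assumes a: "a \<in> carrier A" and uv: "linked u v"
  shows "linked (act\<^sub>1 a u) (act\<^sub>2 a v)"
proof -
  note carr = linked_closed[OF uv]
  obtain x where x: "\<And>b. b \<in> carrier A \<Longrightarrow> x b \<in> carrier L"
    "\<And>b. b \<in> carrier A \<Longrightarrow> \<pi>\<^sub>1 (act\<^sub>1 b u) = \<theta>\<^sub>1 (x b)"
    "\<And>b. b \<in> carrier A \<Longrightarrow> \<pi>\<^sub>2 (act\<^sub>2 b v) = \<theta>\<^sub>2 (x b)"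
    using linked_coord[OF uv] by metis
  \<comment> \<open>Acting by \<open>a\<close> precomposes the coordinate function with right
    multiplication by \<open>a\<close>.\<close>
  show ?thesis
    using carr a x
    by (intro linkedI[where x = "\<lambda>b. x (b \<otimes>\<^bsub>A\<^esub> a)"])
      (auto simp: E1.act_act E2.act_act E1.act_simps E2.act_simps A.mult_closed)
qed

text \<open>One covering element has to serve both actions, so that \<open>linked_mult\<close>
  evaluates both products at the same tensor; the union of the two finite sets provides it.\<close>

lemma common_act_local_unit:
  assumes "u \<in> carrier R\<^sub>1" "v \<in> carrier R\<^sub>2"
  obtains e where "e \<in> carrier A" "act\<^sub>1 e u = u" "act\<^sub>2 e v = v"
proof -
  obtain X where X: "finite X" "X \<subseteq> carrier A"
    "\<And>e. e \<in> carrier A \<Longrightarrow> \<forall>a\<in>X. e \<otimes>\<^bsub>A\<^esub> a = a \<Longrightarrow> act\<^sub>1 e u = u"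
    using E1.act_local_unit[OF A.nonunital_algebra_axioms assms(1)] by blast
  obtain Y where Y: "finite Y" "Y \<subseteq> carrier A"
    "\<And>e. e \<in> carrier A \<Longrightarrow> \<forall>a\<in>Y. e \<otimes>\<^bsub>A\<^esub> a = a \<Longrightarrow> act\<^sub>2 e v = v"
    using E2.act_local_unit[OF A.nonunital_algebra_axioms assms(2)] by blast
  obtain e where e: "e \<in> carrier A" "\<forall>a\<in>X \<union> Y. e \<otimes>\<^bsub>A\<^esub> a = a"
    using local_unitE[OF local_units, of "X \<union> Y"] X(1,2) Y(1,2) by (metis Un_least finite_UnI)
  then show ?thesis using X(3)[of e] Y(3)[of e] that[of e] by simp
qed

lemma linked_mult:
  assumes uv: "linked u v" and uv': "linked u' v'"
  shows "linked (u \<otimes>\<^bsub>R\<^sub>1\<^esub> u') (v \<otimes>\<^bsub>R\<^sub>2\<^esub> v')"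
proof -
  note carr = linked_closed[OF uv] linked_closed[OF uv']
  obtain x where x: "\<And>b. b \<in> carrier A \<Longrightarrow> x b \<in> carrier L"
    "\<And>b. b \<in> carrier A \<Longrightarrow> \<pi>\<^sub>1 (act\<^sub>1 b u) = \<theta>\<^sub>1 (x b)"
    "\<And>b. b \<in> carrier A \<Longrightarrow> \<pi>\<^sub>2 (act\<^sub>2 b v) = \<theta>\<^sub>2 (x b)"
    using linked_coord[OF uv] by metis
  obtain x' where x': "\<And>b. b \<in> carrier A \<Longrightarrow> x' b \<in> carrier L"
    "\<And>b. b \<in> carrier A \<Longrightarrow> \<pi>\<^sub>1 (act\<^sub>1 b u') = \<theta>\<^sub>1 (x' b)"
    "\<And>b. b \<in> carrier A \<Longrightarrow> \<pi>\<^sub>2 (act\<^sub>2 b v') = \<theta>\<^sub>2 (x' b)"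
    using linked_coord[OF uv'] by metis
  obtain e where e: "e \<in> carrier A" "act\<^sub>1 e u' = u'" "act\<^sub>2 e v' = v'"
    using common_act_local_unit[OF carr(3,4)] .
  \<comment> \<open>The coordinate of the product: \<open>x\<close> of the first leg times
    \<open>x'\<close> of the second leg of the coproduct of \<open>b\<close>, covered by
    \<open>e\<close>. It is formed in \<open>L\<close>, without reference to either action.\<close>
  define y where "y b = tensor_lift K L (\<lambda>p q. x p \<otimes>\<^bsub>L\<^esub> x' q) (cov_r2 K A \<Delta> b e)" for b
  note T = A.cov_r2_closed[OF local_units _ e(1)]
  note mods = A.module_axioms A.module_axioms
  show ?thesis
  proof (rule linkedI[where x = y])
    fix b assume b: "b \<in> carrier A"
    show "y b \<in> carrier L"
      unfolding y_def using x(1) x'(1)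
      by (intro tensor_lift_closed[OF mods L.module_axioms T[OF b]] L.mult_closed)
    have "\<pi>\<^sub>1 (act\<^sub>1 b (u \<otimes>\<^bsub>R\<^sub>1\<^esub> u'))
        = \<pi>\<^sub>1 (tensor_lift K R\<^sub>1 (\<lambda>p q. act\<^sub>1 p u \<otimes>\<^bsub>R\<^sub>1\<^esub> act\<^sub>1 q u') (cov_r2 K A \<Delta> b e))"
      using E1.act_mult[of b u u' e] b carr e by simp
    also have "\<dots> = tensor_lift K R\<^sub>1 (\<lambda>p q. \<pi>\<^sub>1 (act\<^sub>1 p u \<otimes>\<^bsub>R\<^sub>1\<^esub> act\<^sub>1 q u')) (cov_r2 K A \<Delta> b e)"
      using carr by (intro tensor_lift_linear[OF mods E1.module_axioms E1.module_axioms
            E1.proj_linear T[OF b]]) (simp add: E1.mult_closed E1.act_simps)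
    \<comment> \<open>\<open>\<pi>\<^sub>1\<close> is multiplicative on all of
      \<open>R\<^sub>1\<close>, so each term splits into coordinates of \<open>u\<close> and
      \<open>u'\<close>, which \<open>\<theta>\<^sub>1\<close> merges into one product in
      \<open>L\<close>.\<close>
    also have "\<dots> = tensor_lift K R\<^sub>1 (\<lambda>p q. \<theta>\<^sub>1 (x p \<otimes>\<^bsub>L\<^esub> x' q)) (cov_r2 K A \<Delta> b e)"
      using carr x x' by (intro tensor_lift_cong[OF mods E1.module_axioms T[OF b]])
        (simp_all add: E1.mult_closed E1.act_simps E1.proj_simps E1.proj_mult E1.theta_mult E1.theta_simps)
    \<comment> \<open>Here \<open>tensor_lift_linear\<close> is read backwards to pull
      \<open>\<theta>\<^sub>1\<close> out of the lift.\<close>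
    also have "\<dots> = \<theta>\<^sub>1 (y b)"
      unfolding y_def using x x' by (intro tensor_lift_linear[symmetric, OF mods L.module_axioms
          E1.module_axioms E1.theta_linear T[OF b]]) (simp add: L.mult_closed)
    finally show "\<pi>\<^sub>1 (act\<^sub>1 b (u \<otimes>\<^bsub>R\<^sub>1\<^esub> u')) = \<theta>\<^sub>1 (y b)" .
    have "\<pi>\<^sub>2 (act\<^sub>2 b (v \<otimes>\<^bsub>R\<^sub>2\<^esub> v'))
        = \<pi>\<^sub>2 (tensor_lift K R\<^sub>2 (\<lambda>p q. act\<^sub>2 p v \<otimes>\<^bsub>R\<^sub>2\<^esub> act\<^sub>2 q v') (cov_r2 K A \<Delta> b e))"
      using E2.act_mult[of b v v' e] b carr e by simp
    also have "\<dots> = tensor_lift K R\<^sub>2 (\<lambda>p q. \<pi>\<^sub>2 (act\<^sub>2 p v \<otimes>\<^bsub>R\<^sub>2\<^esub> act\<^sub>2 q v')) (cov_r2 K A \<Delta> b e)"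
      using carr by (intro tensor_lift_linear[OF mods E2.module_axioms E2.module_axioms
            E2.proj_linear T[OF b]]) (simp add: E2.mult_closed E2.act_simps)
    also have "\<dots> = tensor_lift K R\<^sub>2 (\<lambda>p q. \<theta>\<^sub>2 (x p \<otimes>\<^bsub>L\<^esub> x' q)) (cov_r2 K A \<Delta> b e)"
      using carr x x' by (intro tensor_lift_cong[OF mods E2.module_axioms T[OF b]])
        (simp_all add: E2.mult_closed E2.act_simps E2.proj_simps E2.proj_mult E2.theta_mult E2.theta_simps)
    also have "\<dots> = \<theta>\<^sub>2 (y b)"
      unfolding y_def using x x' by (intro tensor_lift_linear[symmetric, OF mods L.module_axioms
          E2.module_axioms E2.theta_linear T[OF b]]) (simp add: L.mult_closed)
    finally show "\<pi>\<^sub>2 (act\<^sub>2 b (v \<otimes>\<^bsub>R\<^sub>2\<^esub> v')) = \<theta>\<^sub>2 (y b)" .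
  qed (simp_all add: carr E1.mult_closed E2.mult_closed)
qed

text \<open>The domain of the relation is a submodule containing the generators, hence all of
  \<open>R\<^sub>1\<close>.\<close>

lemma linked_total:
  assumes "u \<in> carrier R\<^sub>1"
  shows "\<exists>v. linked u v"
proof -
  let ?H = "{u. \<exists>v. linked u v}"
  have "u \<in> ?H"
  proof (rule E1.generated_induct[OF assms])
    show "submodule ?H K R\<^sub>1"
    proof (rule submodule_smultI[OF E1.module_axioms])
      \<comment> \<open>The zero pair is obtained by scaling a linked pair of generators by the
        scalar zero.\<close>
      have "linked (\<zero>\<^bsub>K\<^esub> \<odot>\<^bsub>R\<^sub>1\<^esub> act\<^sub>1 \<zero>\<^bsub>A\<^esub> (\<theta>\<^sub>1 \<zero>\<^bsub>L\<^esub>)) (\<zero>\<^bsub>K\<^esub> \<odot>\<^bsub>R\<^sub>2\<^esub> act\<^sub>2 \<zero>\<^bsub>A\<^esub> (\<theta>\<^sub>2 \<zero>\<^bsub>L\<^esub>))"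
        by (intro linked_smult linked_gen) auto
      then show "\<zero>\<^bsub>R\<^sub>1\<^esub> \<in> ?H"
        using E1.smult_l_null[OF E1.act_simps(1)[OF A.zero_closed E1.theta_simps(1)[OF L.zero_closed]]]
        by auto
    qed (use linked_add linked_smult linked_closed(1) in blast)+
  qed (use linked_gen in blast)
  then show ?thesis by blast
qed

text \<open>Injectivity of \<open>\<theta>\<^sub>1\<close> forces the coordinates of both pairs to
  coincide. So the family of \<open>v \<ominus> v'\<close> vanishes, and minimality of the second
  action applies.\<close>

lemma linked_unique:
  assumes uv: "linked u v" and uv': "linked u v'"
  shows "v = v'"
proof -
  note carr = linked_closed[OF uv] linked_closed[OF uv']
  have key: "\<pi>\<^sub>2 (act\<^sub>2 b (v \<ominus>\<^bsub>R\<^sub>2\<^esub> v')) = \<zero>\<^bsub>R\<^sub>2\<^esub>" if b: "b \<in> carrier A" for b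
  proof -
    obtain x where x: "x \<in> carrier L" "\<theta>\<^sub>1 x = \<pi>\<^sub>1 (act\<^sub>1 b u)" "\<theta>\<^sub>2 x = \<pi>\<^sub>2 (act\<^sub>2 b v)"
      using uv b unfolding linked_def by blast
    obtain x' where x': "x' \<in> carrier L" "\<theta>\<^sub>1 x' = \<pi>\<^sub>1 (act\<^sub>1 b u)" "\<theta>\<^sub>2 x' = \<pi>\<^sub>2 (act\<^sub>2 b v')"
      using uv' b unfolding linked_def by blast
    have "x = x'" using x x' by (intro inj_onD[OF E1.theta_inj]) auto
    have "act\<^sub>2 b \<in> linear_maps K R\<^sub>2 R\<^sub>2"
      using E2.act_bilinear b unfolding bilinear_maps_def by blast
    then have "\<pi>\<^sub>2 (act\<^sub>2 b (v \<ominus>\<^bsub>R\<^sub>2\<^esub> v')) = \<pi>\<^sub>2 (act\<^sub>2 b v) \<ominus>\<^bsub>R\<^sub>2\<^esub> \<pi>\<^sub>2 (act\<^sub>2 b v')"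
      using carr b by (simp add: linear_map_minus[OF E2.module_axioms E2.module_axioms]
          linear_map_minus[OF E2.module_axioms E2.module_axioms E2.proj_linear] E2.act_simps)
    also have "\<dots> = \<zero>\<^bsub>R\<^sub>2\<^esub>"
      using \<open>x = x'\<close> x x' E2.theta_simps(1)[OF x'(1)] by (simp add: E2.r_neg a_minus_def)
    finally show ?thesis .
  qed
  have "v \<ominus>\<^bsub>R\<^sub>2\<^esub> v' = \<zero>\<^bsub>R\<^sub>2\<^esub>"
    using E2.minus_closed[OF carr(2,4)] key
    by (rule E2.proj_act_zero_imp_zero[OF A.nonunital_algebra_axioms local_units])
  then show ?thesis
    using E2.minus_equality[of v "\<ominus>\<^bsub>R\<^sub>2\<^esub> v'"] carr by (simp add: a_minus_def)
qed

end

section \<open>From the linking relation to the isomorphism\<close>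

theorem theorem3p27:
  fixes K :: "'k ring" and A :: "('k, 'a) module" and \<Delta> :: "('k, 'a) comult"
    and L :: "('k, 'l) module" and pact :: "'a \<Rightarrow> 'l \<Rightarrow> 'l"
    and \<ee> :: "'a \<Rightarrow> ('l \<Rightarrow> 'l) \<times> ('l \<Rightarrow> 'l)"
    and R\<^sub>1 :: "('k, 'r) module" and act\<^sub>1 :: "'a \<Rightarrow> 'r \<Rightarrow> 'r"
    and \<theta>\<^sub>1 :: "'l \<Rightarrow> 'r" and \<pi>\<^sub>1 :: "'r \<Rightarrow> 'r"
    and R\<^sub>2 :: "('k, 's) module" and act\<^sub>2 :: "'a \<Rightarrow> 's \<Rightarrow> 's"
    and \<theta>\<^sub>2 :: "'l \<Rightarrow> 's" and \<pi>\<^sub>2 :: "'s \<Rightarrow> 's"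
  assumes "regular_multiplier_hopf_algebra K A \<Delta>"
    and "symmetric_partial_module_algebra K A \<Delta> L pact \<ee>"
    and "quasi_unitary A L pact"
    and "minimal_enveloping_action K A \<Delta> L pact R\<^sub>1 act\<^sub>1 \<theta>\<^sub>1 \<pi>\<^sub>1"
    and "minimal_enveloping_action K A \<Delta> L pact R\<^sub>2 act\<^sub>2 \<theta>\<^sub>2 \<pi>\<^sub>2"
  shows "\<exists>f. module_algebra_iso K A R\<^sub>1 act\<^sub>1 R\<^sub>2 act\<^sub>2 f"
proof -
  interpret H: regular_multiplier_hopf_algebra K A \<Delta> by fact
  interpret P: symmetric_partial_module_algebra K A \<Delta> L pact \<ee> by fact
  have units: "has_local_units A"
    unfolding has_local_units_def
  proof (intro allI impI)
    fix X assume "finite X \<and> X \<subseteq> carrier A"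
    \<comment> \<open>With no elements of \<open>L\<close> prescribed, the local unit axiom of the
      partial action yields bilateral local units of \<open>A\<close>.\<close>
    then show "\<exists>e\<in>carrier A. \<forall>a\<in>X. a \<otimes>\<^bsub>A\<^esub> e = a \<and> e \<otimes>\<^bsub>A\<^esub> a = a"
      using P.pact_local_units[of X "{}"] by simp
  qed
  note pact = bilinear_map_simps(1)[OF P.pact_bilinear]
  interpret E: enveloping_pair K A \<Delta> L pact R\<^sub>1 act\<^sub>1 \<theta>\<^sub>1 \<pi>\<^sub>1 R\<^sub>2 act\<^sub>2 \<theta>\<^sub>2 \<pi>\<^sub>2
    using assms(4,5) H.multiplier_hopf_algebra_axioms P.nonunital_algebra_axioms units pact
    by (intro enveloping_pair.intro enveloping_pair_axioms.intro)
  \<comment> \<open>With the roles exchanged, totality and uniqueness become surjectivity and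
    injectivity.\<close>
  interpret E': enveloping_pair K A \<Delta> L pact R\<^sub>2 act\<^sub>2 \<theta>\<^sub>2 \<pi>\<^sub>2 R\<^sub>1 act\<^sub>1 \<theta>\<^sub>1 \<pi>\<^sub>1
    using assms(4,5) H.multiplier_hopf_algebra_axioms P.nonunital_algebra_axioms units pact
    by (intro enveloping_pair.intro enveloping_pair_axioms.intro)
  have sym: "E'.linked v u \<longleftrightarrow> E.linked u v" for u v
    unfolding E.linked_def E'.linked_def by blast
  \<comment> \<open>The relation is total and single-valued, so it is the graph of \<open>f\<close>;
    every property of \<open>f\<close> is then read off from a linked pair through
    \<open>f_eq\<close>.\<close>
  define f where "f u = (THE v. E.linked u v)" for u
  have f_eq: "f u = v" if "E.linked u v" for u v
    unfolding f_def using that E.linked_unique by blast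
  have f: "E.linked u (f u)" if "u \<in> carrier R\<^sub>1" for u
    using E.linked_total[OF that] f_eq by blast
  have "f \<in> algebra_homs K R\<^sub>1 R\<^sub>2"
    unfolding algebra_homs_def linear_maps_def
    by (auto intro!: f_eq E.linked_add E.linked_smult E.linked_mult f E.linked_closed(2)[OF f])
  moreover have "f (act\<^sub>1 a u) = act\<^sub>2 a (f u)" if "a \<in> carrier A" "u \<in> carrier R\<^sub>1" for a u
    using that by (intro f_eq E.linked_act f)
  moreover have "bij_betw f (carrier R\<^sub>1) (carrier R\<^sub>2)"
  proof (intro bij_betwI')
    fix u u' assume "u \<in> carrier R\<^sub>1" "u' \<in> carrier R\<^sub>1"
    \<comment> \<open>A common value is linked to both \<open>u\<close> and \<open>u'\<close>, and
      uniqueness for the exchanged pair identifies them.\<close>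
    then show "f u = f u' \<longleftrightarrow> u = u'"
      using E'.linked_unique f sym by metis
  next
    fix v assume "v \<in> carrier R\<^sub>2"
    then show "\<exists>u\<in>carrier R\<^sub>1. v = f u"
      using E'.linked_total sym f_eq E.linked_closed(1) by metis
  qed (use f E.linked_closed(2) in blast)
  ultimately show ?thesis
    unfolding module_algebra_iso_def by blast
qed

end
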